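(* For every $n\in\mathbb{N}$, the $C^*$-algebra $\mathfrak{B}_n:=C^*(\{b_i : |i|\le n\})\subset\mathfrak{B}$ is a full matrix algebra. More precisely, $\mathfrak{B}_n\cong M_{2^{2n+1}}(\mathbb{C})$.
   Context: $\mathfrak{B}$ is the universal unital $C^*$-algebra generated by elements $\{b_i : i\in\mathbb{Z}\}$ (with $b_i^\dagger:=b_i^*$) satisfying, for all $i,j\in\mathbb{Z}$, the monotone rules: (1) $b_ib_j=0$ if $i\le j$; (2) $b_ib_jb_j^\dagger=\alpha_{i,j}b_i$; (3) $b_i^\dagger b_i=b_{i-1}b_{i-1}^\dagger-b_ib_i^\dagger$; (4) $b_ib_i^\dagger b_j=b_j-\alpha_{i,j}\sum_{j<k\le i}b_k^\dagger b_kb_j$; where $\alpha_{i,j}=1$ if $i>j$ and $0$ otherwise. Equivalently, $\mathfrak{B}$ is identified, via $b_i\mapsto a_i$, with the unital $C^*$-algebra of operators generated by $\{a_i:i\in\mathbb{Z}\}$ on the monotone Fock space, i.e. the Hilbert space with orthonormal basis consisting of $\Omega$ and $e_{(i_1,\dots,i_k)}$ ($k\ge1$, $i_1<\cdots<i_k$ integers), where $a_i\Omega=0$ and $a_ie_{(i_1,\dots,i_k)}=e_{(i_2,\dots,i_k)}$ if $i=i_1$ (this being $\Omega$ when $k=1$), and $0$ otherwise. $C^*(S)$ denotes the $C^*$-subalgebra generated by $S$, without adjoining the unit of $\mathfrak{B}$ (so the unit of $\mathfrak{B}_n$ need not be the unit of $\mathfrak{B}$). $\mathbb{N}$ includes $0$.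 *)

theory Defs
  imports
    "HOL-Analysis.Elementary_Normed_Spaces"
    "HOL-Library.Poly_Mapping"
    "Jordan_Normal_Form.Schur_Decomposition"
begin

section \<open>Complex *-algebras and unital C*-algebras\<close>

class scaleC =
  fixes scaleC :: "complex \<Rightarrow> 'a \<Rightarrow> 'a" (infixr \<open>*\<^sub>C\<close> 75)

class star =
  fixes star :: "'a \<Rightarrow> 'a"

class star_algebra = ring_1 + scaleC + star +
  assumes scaleC_add_right: "c *\<^sub>C (x + y) = c *\<^sub>C x + c *\<^sub>C y"
    and scaleC_add_left: "(c + d) *\<^sub>C x = c *\<^sub>C x + d *\<^sub>C x"
    and scaleC_scaleC: "c *\<^sub>C d *\<^sub>C x = (c * d) *\<^sub>C x"
    and scaleC_one: "1 *\<^sub>C x = x"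
    and mult_scaleC_left: "(c *\<^sub>C x) * y = c *\<^sub>C (x * y)"
    and mult_scaleC_right: "x * (c *\<^sub>C y) = c *\<^sub>C (x * y)"
    and star_add: "star (x + y) = star x + star y"
    and star_scaleC: "star (c *\<^sub>C x) = cnj c *\<^sub>C star x"
    and star_mult: "star (x * y) = star y * star x"
    and star_star: "star (star x) = x"
begin

lemma scaleC_zero_right [simp]: "c *\<^sub>C 0 = 0"
  using scaleC_add_right[of c 0 0] by simp

lemma scaleC_zero_left [simp]: "0 *\<^sub>C x = 0"
  using scaleC_add_left[of 0 0 x] by simp

lemma star_zero [simp]: "star 0 = 0"
  using star_add[of 0 0] by simp

lemma star_one [simp]: "star 1 = 1"
proof -
  have "star (star 1 * 1) = star 1" by (subst star_mult) (simp add: star_star)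
  then show ?thesis by (simp add: star_star)
qed

lemma star_eq_zero_iff [simp]: "star x = 0 \<longleftrightarrow> x = 0"
  using star_star star_zero by metis

lemma scaleC_minus_one: "(-1) *\<^sub>C x = - x"
proof -
  have "(-1) *\<^sub>C x + x = (-1 + 1) *\<^sub>C x"
    unfolding scaleC_add_left by (simp add: scaleC_one)
  then show ?thesis by (simp add: eq_neg_iff_add_eq_0)
qed

lemma scaleC_sum_right: "c *\<^sub>C sum f A = (\<Sum>x\<in>A. c *\<^sub>C f x)"
  by (induction A rule: infinite_finite_induct) (simp_all add: scaleC_add_right)

lemma star_sum: "star (sum f A) = (\<Sum>x\<in>A. star (f x))"
  by (induction A rule: infinite_finite_induct) (simp_all add: star_add)

end

text \<open>The class \<open>real_normed_algebra_1\<close> includes \<open>norm 1 = 1\<close>, so the zero algebra is excluded.\<close>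

class cstar_algebra = star_algebra + real_normed_algebra_1 + banach +
  assumes scaleR_scaleC: "r *\<^sub>R x = complex_of_real r *\<^sub>C x"
    and norm_scaleC: "norm (c *\<^sub>C x) = cmod c * norm x"
    and cstar_identity: "norm (star x * x) = (norm x)\<^sup>2"

definition cstar_subalgebra :: "'a::cstar_algebra set \<Rightarrow> bool" where
  "cstar_subalgebra C \<longleftrightarrow> closed C \<and> 0 \<in> C \<and>
     (\<forall>x\<in>C. \<forall>y\<in>C. x + y \<in> C) \<and> (\<forall>c. \<forall>x\<in>C. c *\<^sub>C x \<in> C) \<and>
     (\<forall>x\<in>C. \<forall>y\<in>C. x * y \<in> C) \<and> (\<forall>x\<in>C. star x \<in> C)"

definition cstar_generated :: "'a::cstar_algebra set \<Rightarrow> 'a set" where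
  "cstar_generated S = \<Inter>{C. cstar_subalgebra C \<and> S \<subseteq> C}"

definition unital_star_hom :: "('a::star_algebra \<Rightarrow> 'b::star_algebra) \<Rightarrow> bool" where
  "unital_star_hom f \<longleftrightarrow> f 1 = 1 \<and> (\<forall>x y. f (x + y) = f x + f y) \<and>
     (\<forall>c x. f (c *\<^sub>C x) = c *\<^sub>C f x) \<and> (\<forall>x y. f (x * y) = f x * f y) \<and>
     (\<forall>x. f (star x) = star (f x))"

text \<open>The carrier \<open>C\<close> need not contain the unit of the ambient algebra. As usual, a C*-isomorphism
  is a bijective *-homomorphism; such a map is automatically isometric.\<close>

definition cstar_iso_matrix_algebra :: "nat \<Rightarrow> 'a::cstar_algebra set \<Rightarrow> bool" where
  "cstar_iso_matrix_algebra N C \<longleftrightarrow> cstar_subalgebra C \<and>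
     (\<exists>\<Phi> :: 'a \<Rightarrow> complex mat. bij_betw \<Phi> C (carrier_mat N N) \<and>
        (\<forall>x\<in>C. \<forall>y\<in>C. \<Phi> (x + y) = \<Phi> x + \<Phi> y) \<and>
        (\<forall>c. \<forall>x\<in>C. \<Phi> (c *\<^sub>C x) = c \<cdot>\<^sub>m \<Phi> x) \<and>
        (\<forall>x\<in>C. \<forall>y\<in>C. \<Phi> (x * y) = \<Phi> x * \<Phi> y) \<and>
        (\<forall>x\<in>C. \<Phi> (star x) = mat_adjoint (\<Phi> x)))"


section \<open>The free unital *-algebra\<close>

text \<open>The free unital *-algebra on \<open>'g\<close> is the monoid algebra over the complex numbers of the free
  monoid with involution: a letter is \<open>(g, False)\<close> for the generator \<open>g\<close> and \<open>(g, True)\<close> for its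
  adjoint. The monoid is written additively so that the convolution product of \<open>poly_mapping\<close>
  is the algebra product.\<close>

datatype 'g word = Word "('g \<times> bool) list"

class star_monoid = monoid_add + star +
  assumes star_plus_rev: "star (x + y) = star y + star x"
    and star_invol: "star (star x) = x"

instantiation word :: (type) star_monoid
begin

definition zero_word :: "'a word" where
  "0 = Word []"

fun plus_word :: "'a word \<Rightarrow> 'a word \<Rightarrow> 'a word" where
  "Word u + Word v = Word (u @ v)"

fun star_word :: "'a word \<Rightarrow> 'a word" where
  "star (Word u) = Word (rev (map (\<lambda>(g, s). (g, \<not> s)) u))"

instance
proof
  fix x y z :: "'a word"
  obtain u v w where [simp]: "x = Word u" "y = Word v" "z = Word w"
    by (metis word.exhaust)
  show "x + y + z = x + (y + z)" by simp
  show "0 + x = x" "x + 0 = x" by (simp_all add: zero_word_def)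
  show "star (x + y) = star y + star x" by simp
  show "star (star x) = x"
    by (auto simp: rev_map[symmetric] o_def case_prod_unfold)
qed

end

instantiation complex :: star_algebra
begin

definition scaleC_complex :: "complex \<Rightarrow> complex \<Rightarrow> complex" where
  "scaleC_complex c x = c * x"

definition star_complex :: "complex \<Rightarrow> complex" where
  "star_complex = cnj"

instance
  by standard (simp_all add: scaleC_complex_def star_complex_def algebra_simps)

end

lemma (in star_monoid) star_monoid_zero [simp]: "star 0 = 0"
proof -
  have "star (star 0 + 0) = star 0" by (subst star_plus_rev) (simp add: star_invol)
  then show ?thesis by (simp add: star_invol)
qed

lemma (in star_monoid) star_monoid_eq_iff: "star x = y \<longleftrightarrow> x = star y"
  using star_invol by auto

lemma poly_mapping_sum_single:
  "f = (\<Sum>k\<in>Poly_Mapping.keys f. Poly_Mapping.single k (Poly_Mapping.lookup f k))"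
proof (rule poly_mapping_eqI)
  fix k
  show "Poly_Mapping.lookup f k = Poly_Mapping.lookup
      (\<Sum>k\<in>Poly_Mapping.keys f. Poly_Mapping.single k (Poly_Mapping.lookup f k)) k"
    by (cases "k \<in> Poly_Mapping.keys f")
      (auto simp: lookup_sum lookup_single when_def sum.delta in_keys_iff)
qed

lemma poly_mapping_add_induct [case_names zero single add]:
  fixes f :: "'k \<Rightarrow>\<^sub>0 'b::comm_monoid_add"
  assumes "P 0" "\<And>k c. P (Poly_Mapping.single k c)" "\<And>f g. P f \<Longrightarrow> P g \<Longrightarrow> P (f + g)"
  shows "P f"
proof -
  have "P (\<Sum>k\<in>A. Poly_Mapping.single k (h k))" if "finite A" for A and h :: "'k \<Rightarrow> 'b"
    using that by (induction A) (auto intro: assms)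
  from this[OF finite_keys] show ?thesis
    by (subst poly_mapping_sum_single)
qed

instantiation poly_mapping :: (star_monoid, star_algebra) star_algebra
begin

lift_definition scaleC_poly_mapping :: "complex \<Rightarrow> ('a \<Rightarrow>\<^sub>0 'b) \<Rightarrow> ('a \<Rightarrow>\<^sub>0 'b)"
  is "\<lambda>c f k. c *\<^sub>C f k"
  by (rule finite_subset[rotated]) auto

lift_definition star_poly_mapping :: "('a \<Rightarrow>\<^sub>0 'b) \<Rightarrow> ('a \<Rightarrow>\<^sub>0 'b)"
  is "\<lambda>f k. star (f (star k))"
proof -
  fix f :: "'a \<Rightarrow> 'b"
  assume "finite {k. f k \<noteq> 0}"
  then have "finite (star ` {k. f k \<noteq> 0})" by simp
  moreover have "{k. star (f (star k)) \<noteq> 0} \<subseteq> star ` {k. f k \<noteq> 0}"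
    by (auto simp: image_iff) (metis star_invol)
  ultimately show "finite {k. star (f (star k)) \<noteq> 0}"
    by (rule rev_finite_subset)
qed

lemma scaleC_single: "c *\<^sub>C Poly_Mapping.single (k::'a) (x::'b) = Poly_Mapping.single k (c *\<^sub>C x)"
  by (rule poly_mapping_eqI) (simp add: scaleC_poly_mapping.rep_eq lookup_single when_def)

lemma star_single:
  "star (Poly_Mapping.single (k::'a) (x::'b)) = Poly_Mapping.single (star k) (star x)"
  by (rule poly_mapping_eqI)
    (auto simp: star_poly_mapping.rep_eq lookup_single when_def star_monoid_eq_iff)

instance
proof
  fix c d :: complex and x y :: "'a \<Rightarrow>\<^sub>0 'b"
  show add: "c *\<^sub>C (x + y) = c *\<^sub>C x + c *\<^sub>C y" for x y :: "'a \<Rightarrow>\<^sub>0 'b"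
    by (rule poly_mapping_eqI) (simp add: scaleC_poly_mapping.rep_eq lookup_add scaleC_add_right)
  show "(c + d) *\<^sub>C x = c *\<^sub>C x + d *\<^sub>C x"
    by (rule poly_mapping_eqI) (simp add: scaleC_poly_mapping.rep_eq lookup_add scaleC_add_left)
  show "c *\<^sub>C d *\<^sub>C x = (c * d) *\<^sub>C x"
    by (rule poly_mapping_eqI) (simp add: scaleC_poly_mapping.rep_eq scaleC_scaleC)
  show "1 *\<^sub>C x = x"
    by (rule poly_mapping_eqI) (simp add: scaleC_poly_mapping.rep_eq scaleC_one)
  have [simp]: "c *\<^sub>C (0 :: 'a \<Rightarrow>\<^sub>0 'b) = 0"
    by (rule poly_mapping_eqI) (simp add: scaleC_poly_mapping.rep_eq)
  have [simp]: "star (0 :: 'a \<Rightarrow>\<^sub>0 'b) = 0"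
    by (rule poly_mapping_eqI) (simp add: star_poly_mapping.rep_eq)
  show "(c *\<^sub>C x) * y = c *\<^sub>C (x * y)"
  proof (induction x rule: poly_mapping_add_induct)
    case (single k a)
    show ?case
      by (induction y rule: poly_mapping_add_induct)
        (simp_all add: scaleC_single mult_single mult_scaleC_left distrib_left add)
  qed (simp_all add: add distrib_right)
  show "x * (c *\<^sub>C y) = c *\<^sub>C (x * y)"
  proof (induction x rule: poly_mapping_add_induct)
    case (single k a)
    show ?case
      by (induction y rule: poly_mapping_add_induct)
        (simp_all add: scaleC_single mult_single mult_scaleC_right distrib_left add)
  qed (simp_all add: add distrib_right)
  show sadd: "star (x + y) = star x + star y" for x y :: "'a \<Rightarrow>\<^sub>0 'b"
    by (rule poly_mapping_eqI) (simp add: star_poly_mapping.rep_eq lookup_add star_add)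
  show "star (c *\<^sub>C x) = cnj c *\<^sub>C star x"
    by (rule poly_mapping_eqI)
      (simp add: scaleC_poly_mapping.rep_eq star_poly_mapping.rep_eq star_scaleC)
  show "star (x * y) = star y * star x"
  proof (induction x rule: poly_mapping_add_induct)
    case (single k a)
    show ?case
      by (induction y rule: poly_mapping_add_induct)
        (simp_all add: star_single mult_single star_mult star_plus_rev
          distrib_left distrib_right sadd)
  qed (simp_all add: sadd distrib_right distrib_left)
  show "star (star x) = x"
    by (rule poly_mapping_eqI) (simp add: star_poly_mapping.rep_eq star_star star_invol)
qed

end

type_synonym 'g free_star_algebra = "'g word \<Rightarrow>\<^sub>0 complex"

definition free_gen :: "'g \<Rightarrow> 'g free_star_algebra" where
  "free_gen g = Poly_Mapping.single (Word [(g, False)]) 1"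

fun word_eval :: "('g \<Rightarrow> 'a::star_algebra) \<Rightarrow> 'g word \<Rightarrow> 'a" where
  "word_eval b (Word u) = prod_list (map (\<lambda>(g, s). if s then star (b g) else b g) u)"

definition free_eval :: "('g \<Rightarrow> 'a::star_algebra) \<Rightarrow> 'g free_star_algebra \<Rightarrow> 'a" where
  "free_eval b f = (\<Sum>w\<in>Poly_Mapping.keys f. Poly_Mapping.lookup f w *\<^sub>C word_eval b w)"

lemma word_eval_zero: "word_eval b 0 = 1"
  by (simp add: zero_word_def)

lemma word_eval_plus: "word_eval b (u + v) = word_eval b u * word_eval b v"
  by (cases u; cases v) simp

lemma word_eval_star: "word_eval b (star u) = star (word_eval b u)"
proof (cases u)
  case (Word l)
  have "prod_list (map (\<lambda>(g, s). if s then star (b g) else b g) (rev (map (\<lambda>(g, s). (g, \<not> s)) l)))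
      = star (prod_list (map (\<lambda>(g, s). if s then star (b g) else b g) l))"
    by (induction l) (auto simp: star_mult star_star)
  then show ?thesis by (simp add: Word)
qed

lemma free_eval_superset:
  assumes "finite A" "Poly_Mapping.keys f \<subseteq> A"
  shows "free_eval b f = (\<Sum>w\<in>A. Poly_Mapping.lookup f w *\<^sub>C word_eval b w)"
  unfolding free_eval_def using assms
  by (intro sum.mono_neutral_left) (auto simp: in_keys_iff)

lemma free_eval_single: "free_eval b (Poly_Mapping.single w c) = c *\<^sub>C word_eval b w"
  by (subst free_eval_superset[of "{w}"]) auto

lemma free_eval_zero [simp]: "free_eval b 0 = 0"
  by (simp add: free_eval_def)

lemma free_eval_add: "free_eval b (f + g) = free_eval b f + free_eval b g"
proof -
  let ?A = "Poly_Mapping.keys f \<union> Poly_Mapping.keys g"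
  have "Poly_Mapping.keys (f + g) \<subseteq> ?A" by (rule Poly_Mapping.keys_add)
  then show ?thesis
    by (simp add: free_eval_superset[of ?A] lookup_add scaleC_add_left sum.distrib)
qed

lemma free_eval_gen [simp]: "free_eval b (free_gen g) = b g"
  by (simp add: free_gen_def free_eval_single scaleC_one)

lemma unital_star_hom_free_eval: "unital_star_hom (free_eval b)"
  unfolding unital_star_hom_def
proof (intro conjI allI)
  fix c :: complex and x y :: "'a free_star_algebra"
  show "free_eval b 1 = 1"
    using free_eval_single[of b 0 1] by (simp add: word_eval_zero scaleC_one)
  show "free_eval b (x + y) = free_eval b x + free_eval b y"
    by (rule free_eval_add)
  show "free_eval b (c *\<^sub>C x) = c *\<^sub>C free_eval b x"
    by (induction x rule: poly_mapping_add_induct)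
      (simp_all add: free_eval_single free_eval_add scaleC_add_right scaleC_single
        scaleC_scaleC scaleC_complex_def)
  show "free_eval b (x * y) = free_eval b x * free_eval b y"
  proof (induction x rule: poly_mapping_add_induct)
    case (single k a)
    show ?case
      by (induction y rule: poly_mapping_add_induct)
        (simp_all add: free_eval_single free_eval_add mult_single word_eval_plus distrib_left
          scaleC_scaleC mult_scaleC_left mult_scaleC_right mult.commute)
  qed (simp_all add: free_eval_add distrib_right)
  show "free_eval b (star x) = star (free_eval b x)"
    by (induction x rule: poly_mapping_add_induct)
      (simp_all add: free_eval_single free_eval_add star_single star_add star_scaleC
        word_eval_star star_complex_def)
qed


section \<open>Universal unital C*-algebras\<close>

definition cstar_seminorm :: "('a::star_algebra \<Rightarrow> real) \<Rightarrow> bool" where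
  "cstar_seminorm p \<longleftrightarrow> (\<forall>x. 0 \<le> p x) \<and> (\<forall>x y. p (x + y) \<le> p x + p y) \<and>
     (\<forall>c x. p (c *\<^sub>C x) = cmod c * p x) \<and> (\<forall>x y. p (x * y) \<le> p x * p y) \<and>
     (\<forall>x. p (star x * x) = (p x)\<^sup>2)"

text \<open>The universal unital C*-algebra with generators \<open>'g\<close> and relators \<open>R\<close> is the Hausdorff
  completion of the free unital *-algebra with respect to the largest C*-seminorm that annihilates
  \<open>R\<close>. A unital C*-algebra \<open>'a\<close> with elements \<open>b g\<close> is such a completion iff it is generated by its
  unit and the \<open>b g\<close>, and the seminorm that it induces on the free *-algebra annihilates \<open>R\<close> and is
  the largest to do so. Theorem \<open>universal_cstar_property\<close> below is the resulting mapping property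
  into every unital C*-algebra.\<close>

definition universal_cstar :: "'g free_star_algebra set \<Rightarrow> ('g \<Rightarrow> 'a::cstar_algebra) \<Rightarrow> bool" where
  "universal_cstar R b \<longleftrightarrow>
     cstar_generated (insert 1 (range b)) = UNIV \<and>
     (\<forall>r\<in>R. free_eval b r = 0) \<and>
     (\<forall>p. cstar_seminorm p \<and> (\<forall>r\<in>R. p r = 0) \<longrightarrow> (\<forall>x. p x \<le> norm (free_eval b x)))"

lemma norm_star [simp]: "norm (star x) = norm (x::'a::cstar_algebra)"
proof -
  have le: "norm y \<le> norm (star y)" for y :: 'a
  proof (cases "y = 0")
    case False
    have "norm y * norm y \<le> norm (star y) * norm y"
      using norm_mult_ineq[of "star y" y] by (simp add: cstar_identity power2_eq_square)
    then show ?thesis using False by simp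
  qed simp
  show ?thesis using le[of x] le[of "star x"] by (simp add: star_star)
qed

lemma star_diff: "star (x - y) = star x - star (y::'a::star_algebra)"
  using star_add[of "x - y" y] by (simp add: algebra_simps)

lemma scaleC_diff_right: "c *\<^sub>C (x - y) = c *\<^sub>C x - c *\<^sub>C (y::'a::star_algebra)"
  using scaleC_add_right[of c "x - y" y] by (simp add: algebra_simps)

lemma continuous_on_star [continuous_intros]:
  fixes f :: "'b::metric_space \<Rightarrow> 'a::cstar_algebra"
  assumes "continuous_on S f"
  shows "continuous_on S (\<lambda>x. star (f x))"
proof -
  have "continuous_on UNIV (star :: 'a \<Rightarrow> 'a)"
    by (auto simp: continuous_on_iff dist_norm star_diff[symmetric])
  from continuous_on_compose2[OF this assms] show ?thesis by simp
qed

lemma continuous_on_scaleC [continuous_intros]: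
  fixes f :: "'b::metric_space \<Rightarrow> 'a::cstar_algebra"
  assumes "continuous_on S f"
  shows "continuous_on S (\<lambda>x. c *\<^sub>C f x)"
proof -
  have "bounded_linear (\<lambda>x::'a. c *\<^sub>C x)"
    by (rule bounded_linear_intro[where K = "cmod c"])
      (simp_all add: scaleC_add_right scaleR_scaleC scaleC_scaleC norm_scaleC mult.commute)
  then have "continuous_on UNIV (\<lambda>x::'a. c *\<^sub>C x)"
    by (rule linear_continuous_on)
  from continuous_on_compose2[OF this assms] show ?thesis by simp
qed

lemma unital_star_homD:
  assumes "unital_star_hom f"
  shows "f 1 = 1" "f (x + y) = f x + f y" "f (c *\<^sub>C x) = c *\<^sub>C f x" "f (x * y) = f x * f y"
    "f (star x) = star (f x)" "f 0 = 0" "f (- x) = - f x" "f (x - y) = f x - f y"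
    "f (sum g A) = (\<Sum>a\<in>A. f (g a))"
proof -
  show add: "f (x + y) = f x + f y" for x y using assms by (simp add: unital_star_hom_def)
  show "f 1 = 1" "f (c *\<^sub>C x) = c *\<^sub>C f x" "f (x * y) = f x * f y" "f (star x) = star (f x)"
    using assms by (simp_all add: unital_star_hom_def)
  show z: "f 0 = 0" using add[of 0 0] by simp
  show m: "f (- x) = - f x" for x using add[of x "- x"] z by (simp add: eq_neg_iff_add_eq_0 add.commute)
  show "f (x - y) = f x - f y" using add[of x "- y"] m by simp
  show "f (sum g A) = (\<Sum>a\<in>A. f (g a))"
    by (induction A rule: infinite_finite_induct) (simp_all add: z add)
qed

lemma cstar_seminorm_norm_hom:
  fixes f :: "'b::star_algebra \<Rightarrow> 'a::cstar_algebra"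
  assumes "unital_star_hom f"
  shows "cstar_seminorm (\<lambda>x. norm (f x))"
  unfolding cstar_seminorm_def
  by (simp add: unital_star_homD[OF assms] norm_triangle_ineq norm_mult_ineq norm_scaleC
      cstar_identity)

lemma closure_range_free_eval:
  fixes b :: "'g \<Rightarrow> 'a::cstar_algebra"
  assumes gen: "cstar_generated (insert 1 (range b)) = UNIV"
  shows "closure (range (free_eval b)) = UNIV"
proof -
  note hom = unital_star_homD[OF unital_star_hom_free_eval[of b]]
  let ?D = "range (free_eval b)"
  have un: "f x \<in> closure ?D" if "x \<in> closure ?D" "f ` ?D \<subseteq> ?D" "continuous_on UNIV f"
    for f :: "'a \<Rightarrow> 'a" and x
  proof -
    have "closed (f -` closure ?D)"
      using that(3) by (simp add: continuous_closed_vimage continuous_on_eq_continuous_at)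
    moreover have "?D \<subseteq> f -` closure ?D" using that(2) closure_subset by blast
    ultimately have "closure ?D \<subseteq> f -` closure ?D" by (rule closure_minimal[rotated])
    then show ?thesis using that(1) by blast
  qed
  have bin: "f x y \<in> closure ?D"
    if xy: "x \<in> closure ?D" "y \<in> closure ?D"
      and D: "\<And>u v. u \<in> ?D \<Longrightarrow> v \<in> ?D \<Longrightarrow> f u v \<in> ?D"
      and cl: "\<And>v. continuous_on UNIV (\<lambda>u. f u v)"
      and cr: "\<And>u. continuous_on UNIV (\<lambda>v. f u v)"
    for f :: "'a \<Rightarrow> 'a \<Rightarrow> 'a" and x y
  proof -
    have 1: "f u y \<in> closure ?D" if "u \<in> ?D" for u
      by (rule un[OF xy(2) _ cr]) (use D that in blast)
    have "closed ((\<lambda>u. f u y) -` closure ?D)"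
      using cl by (simp add: continuous_closed_vimage continuous_on_eq_continuous_at)
    moreover have "?D \<subseteq> (\<lambda>u. f u y) -` closure ?D" using 1 by blast
    ultimately have "closure ?D \<subseteq> (\<lambda>u. f u y) -` closure ?D" by (rule closure_minimal[rotated])
    then show ?thesis using xy(1) by blast
  qed
  have "cstar_subalgebra (closure ?D)"
    unfolding cstar_subalgebra_def
  proof (intro conjI allI ballI)
    show "0 \<in> closure ?D"
      using closure_subset[of ?D] hom(6) by (metis rangeI subsetD)
  next
    fix x y assume "x \<in> closure ?D" "y \<in> closure ?D"
    then show "x + y \<in> closure ?D"
      by (rule bin) (auto simp: hom(2)[symmetric] intro!: continuous_intros)
  next
    fix x y assume "x \<in> closure ?D" "y \<in> closure ?D"
    then show "x * y \<in> closure ?D"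
      by (rule bin) (auto simp: hom(4)[symmetric] intro!: continuous_intros)
  next
    fix c x assume "x \<in> closure ?D"
    then show "c *\<^sub>C x \<in> closure ?D"
      by (rule un) (auto simp: hom(3)[symmetric] intro!: continuous_intros)
  next
    fix x assume "x \<in> closure ?D"
    then show "star x \<in> closure ?D"
      by (rule un) (auto simp: hom(5)[symmetric] intro!: continuous_intros)
  qed simp
  moreover have "insert 1 (range b) \<subseteq> closure ?D"
  proof -
    have "1 \<in> ?D" using hom(1) by (metis rangeI)
    moreover have "b g \<in> ?D" for g by (metis free_eval_gen rangeI)
    ultimately show ?thesis using closure_subset[of ?D] by blast
  qed
  ultimately have "cstar_generated (insert 1 (range b)) \<subseteq> closure ?D"
    unfolding cstar_generated_def by blast
  with gen show ?thesis by blast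
qed

theorem universal_cstar_property:
  fixes b :: "'g \<Rightarrow> 'a::cstar_algebra" and c :: "'g \<Rightarrow> 'b::cstar_algebra"
  assumes univ: "universal_cstar R b" and rel: "\<forall>r\<in>R. free_eval c r = 0"
  shows "\<exists>!h. unital_star_hom h \<and> continuous_on UNIV h \<and> (\<forall>g. h (b g) = c g)"
proof -
  note homb = unital_star_homD[OF unital_star_hom_free_eval[of b]]
  note homc = unital_star_homD[OF unital_star_hom_free_eval[of c]]
  let ?D = "range (free_eval b)"
  have dense: "closure ?D = UNIV"
    using univ by (intro closure_range_free_eval) (simp add: universal_cstar_def)
  have le: "norm (free_eval c x) \<le> norm (free_eval b x)" for x
  proof -
    have "cstar_seminorm p \<and> (\<forall>r\<in>R. p r = 0) \<longrightarrow> (\<forall>x. p x \<le> norm (free_eval b x))" for p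
      using univ by (simp add: universal_cstar_def)
    from this[of "\<lambda>x. norm (free_eval c x)"] show ?thesis
      using rel cstar_seminorm_norm_hom[OF unital_star_hom_free_eval[of c]] by simp
  qed
  have wd: "free_eval c x = free_eval c y" if "free_eval b x = free_eval b y" for x y
    using le[of "x - y"] that by (simp add: homb(8) homc(8))
  define k where "k y = free_eval c (SOME x. free_eval b x = y)" for y
  have k: "k (free_eval b x) = free_eval c x" for x
    unfolding k_def by (rule wd, rule someI) (rule refl)
  have "uniformly_continuous_on ?D k"
    unfolding uniformly_continuous_on_def
  proof (intro allI impI)
    fix e :: real assume "e > 0"
    moreover have "dist (k y) (k z) \<le> dist y z" if "y \<in> ?D" "z \<in> ?D" for y z
      using that le by (auto simp: k dist_norm homb(8)[symmetric] homc(8)[symmetric])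
    ultimately show "\<exists>d>0. \<forall>x\<in>?D. \<forall>x'\<in>?D. dist x' x < d \<longrightarrow> dist (k x') (k x) < e"
      by (meson le_less_trans)
  qed
  from uniformly_continuous_on_extension_on_closure[OF this] obtain h where
    h: "uniformly_continuous_on (closure ?D) h" "\<And>x. x \<in> ?D \<Longrightarrow> k x = h x"
    by metis
  have cont: "continuous_on UNIV h"
    using uniformly_continuous_imp_continuous[OF h(1)] dense by simp
  have hk: "h (free_eval b x) = free_eval c x" for x
    using h(2)[of "free_eval b x"] k by simp
  have eqI: "u x = v x" if "continuous_on UNIV u" "continuous_on UNIV v"
    "\<And>z. u (free_eval b z) = v (free_eval b z)" for u v :: "'a \<Rightarrow> 'b" and x
  proof -
    have "closed {x. u x = v x}" using that by (intro closed_Collect_eq)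
    then have "closure ?D \<subseteq> {x. u x = v x}" using that(3) by (intro closure_minimal) auto
    then show ?thesis using dense by blast
  qed
  have ch [continuous_intros]: "continuous_on UNIV (\<lambda>x. h (f x))"
    if "continuous_on UNIV f" for f :: "'a \<Rightarrow> 'a"
    using continuous_on_compose2[OF cont that] by simp
  have hom: "unital_star_hom h"
    unfolding unital_star_hom_def
  proof (intro conjI allI)
    fix a x y
    show "h 1 = 1" using hk[of 1] homb(1) homc(1) by simp
    have 1: "h (x + free_eval b z) = h x + h (free_eval b z)" for x z
      by (rule eqI[of "\<lambda>x. h (x + free_eval b z)"])
        (auto intro!: continuous_intros simp: homb(2)[symmetric] hk homc(2))
    show "h (x + y) = h x + h y"
      by (rule eqI[of "\<lambda>y. h (x + y)"]) (auto intro!: continuous_intros simp: 1)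
    have 2: "h (x * free_eval b z) = h x * h (free_eval b z)" for x z
      by (rule eqI[of "\<lambda>x. h (x * free_eval b z)"])
        (auto intro!: continuous_intros simp: homb(4)[symmetric] hk homc(4))
    show "h (x * y) = h x * h y"
      by (rule eqI[of "\<lambda>y. h (x * y)"]) (auto intro!: continuous_intros simp: 2)
    show "h (a *\<^sub>C x) = a *\<^sub>C h x"
      by (rule eqI[of "\<lambda>x. h (a *\<^sub>C x)"])
        (auto intro!: continuous_intros simp: homb(3)[symmetric] hk homc(3))
    show "h (star x) = star (h x)"
      by (rule eqI[of "\<lambda>x. h (star x)"])
        (auto intro!: continuous_intros simp: homb(5)[symmetric] hk homc(5))
  qed
  have hb: "h (b g) = c g" for g using hk[of "free_gen g"] by simp
  show ?thesis
  proof (rule ex1I[of _ h])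
    show "unital_star_hom h \<and> continuous_on UNIV h \<and> (\<forall>g. h (b g) = c g)"
      using hom cont hb by blast
  next
    fix h' assume h': "unital_star_hom h' \<and> continuous_on UNIV h' \<and> (\<forall>g. h' (b g) = c g)"
    then have h'_hom: "unital_star_hom h'" and b': "\<And>g. h' (b g) = c g" by auto
    note homh' = unital_star_homD[OF h'_hom]
    have "h' (word_eval b w) = word_eval c w" for w
    proof (cases w)
      case (Word l)
      have "h' (prod_list (map (\<lambda>(g, s). if s then star (b g) else b g) l)) =
          prod_list (map (\<lambda>(g, s). if s then star (c g) else c g) l)"
        by (induction l) (auto simp: homh' b')
      then show ?thesis by (simp add: Word)
    qed
    then have "h' (free_eval b z) = free_eval c z" for z
      by (simp add: free_eval_def homh')
    then have "h' x = h x" for x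
      using h' cont hk by - (rule eqI, auto)
    then show "h' = h" by blast
  qed
qed


section \<open>The monotone rules\<close>

definition monotone_coeff :: "int \<Rightarrow> int \<Rightarrow> complex" where
  "monotone_coeff i j = (if i > j then 1 else 0)"

text \<open>Each rule \<open>lhs = rhs\<close> is recorded as the relator \<open>lhs - rhs\<close>.\<close>

definition monotone_relators :: "(int \<Rightarrow> 'a::star_algebra) \<Rightarrow> 'a set" where
  "monotone_relators b =
     {b i * b j | i j. i \<le> j} \<union>
     {b i * b j * star (b j) - monotone_coeff i j *\<^sub>C b i | i j. True} \<union>
     {star (b i) * b i - (b (i - 1) * star (b (i - 1)) - b i * star (b i)) | i. True} \<union>
     {b i * star (b i) * b j -
        (b j - monotone_coeff i j *\<^sub>C (\<Sum>k\<in>{j<..i}. star (b k) * b k * b j)) | i j. True}"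

lemma monotone_relators_hom:
  assumes "unital_star_hom f"
  shows "f ` monotone_relators b = monotone_relators (\<lambda>i. f (b i))"
proof -
  have 1: "f ` {F i | i. True} = {f (F i) | i. True}" for F :: "int \<Rightarrow> 'a"
    by blast
  have 2: "f ` {F i j | i j. P i j} = {f (F i j) | i j. P i j}"
    for F :: "int \<Rightarrow> int \<Rightarrow> 'a" and P
    by blast
  show ?thesis
    by (simp only: monotone_relators_def image_Un 1 2 unital_star_homD[OF assms])
qed

definition universal_monotone_cstar :: "(int \<Rightarrow> 'a::cstar_algebra) \<Rightarrow> bool" where
  "universal_monotone_cstar b \<longleftrightarrow> universal_cstar (monotone_relators free_gen) b"

lemma universal_monotone_cstar_rules:
  assumes "universal_monotone_cstar b"
  shows "i \<le> j \<Longrightarrow> b i * b j = 0"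
    and "b i * b j * star (b j) = monotone_coeff i j *\<^sub>C b i"
    and "star (b i) * b i = b (i - 1) * star (b (i - 1)) - b i * star (b i)"
    and "b i * star (b i) * b j =
      b j - monotone_coeff i j *\<^sub>C (\<Sum>k\<in>{j<..i}. star (b k) * b k * b j)"
proof -
  have "free_eval b ` monotone_relators free_gen \<subseteq> {0}"
    using assms by (auto simp: universal_monotone_cstar_def universal_cstar_def)
  then have *: "r = 0" if "r \<in> monotone_relators b" for r
    using that by (auto simp: monotone_relators_hom[OF unital_star_hom_free_eval])
  show "b i * b j = 0" if "i \<le> j"
    by (rule *) (use that in \<open>auto simp: monotone_relators_def\<close>)
  show "b i * b j * star (b j) = monotone_coeff i j *\<^sub>C b i"
    by (subst eq_iff_diff_eq_0, rule *) (auto simp: monotone_relators_def)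
  show "star (b i) * b i = b (i - 1) * star (b (i - 1)) - b i * star (b i)"
    by (subst eq_iff_diff_eq_0, rule *) (auto simp: monotone_relators_def)
  show "b i * star (b i) * b j =
      b j - monotone_coeff i j *\<^sub>C (\<Sum>k\<in>{j<..i}. star (b k) * b k * b j)"
    by (subst eq_iff_diff_eq_0, rule *) (unfold monotone_relators_def, blast)
qed

end

theory Submission
  imports Defs "HOL-Analysis.L2_Norm"
begin

text \<open>Write \<open>p\<^sub>i\<close> for the projection \<open>b\<^sub>i b\<^sub>i\<^sup>*\<close> and, for a set \<open>A = {i\<^sub>1 < \<dots> < i\<^sub>k}\<close> of integers in \<open>[-n, n]\<close>,
  put \<open>w\<^sub>A = b\<^sub>i\<^sub>1\<^sup>* \<dots> b\<^sub>i\<^sub>k\<^sup>*\<close>. The rules make the elements \<open>w\<^sub>A p\<^sub>n w\<^sub>B\<^sup>*\<close> a system of matrix units in the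
  algebra. In the Fock picture \<open>p\<^sub>n\<close> is the projection onto the vectors whose indices all exceed \<open>n\<close>.
  Telescoping \<open>p\<^sub>i\<^sub>-\<^sub>1 = p\<^sub>i + b\<^sub>i\<^sup>* b\<^sub>i\<close> down from \<open>n\<close> writes \<open>p\<^sub>i\<close> as a sum of diagonal units, and
  \<open>b\<^sub>i = p\<^sub>i b\<^sub>i\<close> then expresses the generators through the units. What remains is
  \<open>p\<^sub>n \<noteq> 0\<close>: since the family \<open>b = 0\<close> satisfies all the rules, this needs universality, applied to
  the C*-seminorm of the Fock representation.\<close>

section \<open>Matrix units in a C*-algebra\<close>

lemma scaleC_diff_left: "(c - d) *\<^sub>C x = c *\<^sub>C x - d *\<^sub>C (x::'a::star_algebra)"
  using scaleC_add_left[of "c - d" d x] by (simp add: algebra_simps)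

lemma scaleC_cancel_right:
  fixes x :: "'a::cstar_algebra"
  assumes "x \<noteq> 0" "c *\<^sub>C x = d *\<^sub>C x"
  shows "c = d"
proof -
  have "norm ((c - d) *\<^sub>C x) = 0"
    using assms(2) by (simp add: scaleC_diff_left)
  with assms(1) show ?thesis by (simp add: norm_scaleC)
qed

text \<open>For \<open>x \<noteq> 0\<close> the map from scalars to multiples of \<open>x\<close>
  scales norms by the constant factor \<open>norm x\<close>, so its image inherits completeness from
  the complex plane.\<close>

lemma closed_range_scaleC:
  fixes x :: "'a::cstar_algebra"
  shows "closed (range (\<lambda>c. c *\<^sub>C x))"
proof (cases "x = 0")
  case True
  then show ?thesis by simp
next
  case False
  have "complete ((\<lambda>c. c *\<^sub>C x) ` UNIV)"
  proof (rule complete_isometric_image[OF _ real_vector.subspace_UNIV])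
    show "0 < norm x" using False by simp
    show "bounded_linear (\<lambda>c::complex. c *\<^sub>C x)"
      by (rule bounded_linear_intro[where K = "norm x"])
        (simp_all add: scaleC_add_left scaleR_scaleC scaleC_scaleC norm_scaleC scaleR_conv_of_real)
    show "\<forall>c\<in>UNIV. norm x * norm c \<le> norm (c *\<^sub>C x)"
      by (simp add: norm_scaleC mult.commute)
  qed (rule complete_UNIV)
  then show ?thesis by (rule complete_imp_closed)
qed

lemma mat_adjoint_carrier:
  "M \<in> carrier_mat m n \<Longrightarrow> mat_adjoint M \<in> carrier_mat n m"
  by (auto simp: mat_adjoint_def mat_of_rows_def)

lemma mat_adjoint_index:
  fixes M :: "complex mat"
  assumes "M \<in> carrier_mat m n" "i < n" "j < m"
  shows "mat_adjoint M $$ (i, j) = cnj (M $$ (j, i))"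
  using assms by (auto simp: mat_adjoint_def mat_of_rows_def)

lemma cstar_generated_least:
  "cstar_subalgebra C \<Longrightarrow> S \<subseteq> C \<Longrightarrow> cstar_generated S \<subseteq> C"
  by (auto simp: cstar_generated_def)

lemma cstar_generated_superset: "S \<subseteq> cstar_generated S"
  by (auto simp: cstar_generated_def)

lemma cstar_subalgebra_generated: "cstar_subalgebra (cstar_generated S)"
  unfolding cstar_subalgebra_def
proof (intro conjI)
  show "closed (cstar_generated S)"
    unfolding cstar_generated_def by (rule closed_Inter) (auto simp: cstar_subalgebra_def)
qed (auto simp: cstar_generated_def cstar_subalgebra_def)

lemma cstar_subalgebra_sum:
  assumes "cstar_subalgebra C" "\<And>a. a \<in> A \<Longrightarrow> f a \<in> C"
  shows "sum f A \<in> C"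
  using assms(2)
  by (induction A rule: infinite_finite_induct) (use assms(1) in \<open>auto simp: cstar_subalgebra_def\<close>)

section \<open>Abstract systems of matrix units\<close>

text \<open>The diagonal units may add up to a projection other than \<open>1\<close>, so that the
  span can be a matrix algebra with a unit of its own.\<close>

locale cstar_matrix_units =
  fixes N :: nat and F :: "nat \<Rightarrow> nat \<Rightarrow> 'a::cstar_algebra"
  assumes unit_mult: "\<lbrakk>i < N; j < N; k < N; l < N\<rbrakk> \<Longrightarrow> F i j * F k l = (if j = k then F i l else 0)"
    and unit_star: "\<lbrakk>i < N; j < N\<rbrakk> \<Longrightarrow> star (F i j) = F j i"
    and unit_diag_nonzero: "i < N \<Longrightarrow> F i i \<noteq> 0"
begin

definition of_mat :: "complex mat \<Rightarrow> 'a" where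
  "of_mat M = (\<Sum>i<N. \<Sum>j<N. M $$ (i, j) *\<^sub>C F i j)"

abbreviation unit_span :: "'a set" where
  "unit_span \<equiv> of_mat ` carrier_mat N N"

lemma unit_nonzero: "i < N \<Longrightarrow> j < N \<Longrightarrow> F i j \<noteq> 0"
  using unit_mult[of i j j i] unit_diag_nonzero[of i] by auto

text \<open>Only the \<open>(k, l)\<close> term survives between the two diagonal units, so
  compression reads off single matrix entries. Injectivity of \<open>of_mat\<close> and closedness
  of its image both rest on this.\<close>

lemma of_mat_compress:
  assumes "k < N" "l < N"
  shows "F k k * of_mat M * F l l = M $$ (k, l) *\<^sub>C F k l"
proof -
  have "F k k * of_mat M * F l l = (\<Sum>i<N. \<Sum>j<N. M $$ (i, j) *\<^sub>C (F k k * F i j * F l l))"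
    by (simp add: of_mat_def sum_distrib_left sum_distrib_right mult_scaleC_left mult_scaleC_right)
  also have "\<dots> = (\<Sum>i<N. \<Sum>j<N. if i = k \<and> j = l then M $$ (k, l) *\<^sub>C F k l else 0)"
    by (intro sum.cong refl) (auto simp: unit_mult assms)
  also have "\<dots> = (\<Sum>i<N. if i = k then M $$ (k, l) *\<^sub>C F k l else 0)"
    by (intro sum.cong refl) (auto simp: assms)
  also have "\<dots> = M $$ (k, l) *\<^sub>C F k l"
    by (simp add: assms)
  finally show ?thesis .
qed

lemma inj_on_of_mat: "inj_on of_mat (carrier_mat N N)"
proof (rule inj_onI)
  fix M M' assume M: "M \<in> carrier_mat N N" "M' \<in> carrier_mat N N" and eq: "of_mat M = of_mat M'"
  have "M $$ (i, j) = M' $$ (i, j)" if "i < N" "j < N" for i j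
    using of_mat_compress[OF that, of M] of_mat_compress[OF that, of M'] unit_nonzero[OF that] eq
    by (metis scaleC_cancel_right)
  with M show "M = M'" by (intro eq_matI) auto
qed

lemma of_mat_add:
  assumes "M \<in> carrier_mat N N" "M' \<in> carrier_mat N N"
  shows "of_mat (M + M') = of_mat M + of_mat M'"
  using assms by (simp add: of_mat_def scaleC_add_left sum.distrib)

lemma of_mat_smult:
  assumes "M \<in> carrier_mat N N"
  shows "of_mat (c \<cdot>\<^sub>m M) = c *\<^sub>C of_mat M"
  using assms by (simp add: of_mat_def scaleC_scaleC scaleC_sum_right)

lemma of_mat_mult:
  assumes "M \<in> carrier_mat N N" "M' \<in> carrier_mat N N"
  shows "of_mat (M * M') = of_mat M * of_mat M'"
proof -
  have "of_mat M * of_mat M' =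
      (\<Sum>i<N. \<Sum>j<N. \<Sum>k<N. \<Sum>l<N. (M $$ (i, j) * M' $$ (k, l)) *\<^sub>C (F i j * F k l))"
    unfolding of_mat_def sum_distrib_right
    by (simp add: sum_distrib_left mult_scaleC_left mult_scaleC_right scaleC_scaleC mult.commute)
  also have "\<dots> = (\<Sum>i<N. \<Sum>j<N. \<Sum>k<N. if k = j
      then \<Sum>l<N. (M $$ (i, j) * M' $$ (j, l)) *\<^sub>C F i l else 0)"
    by (intro sum.cong refl) (auto simp: unit_mult)
  also have "\<dots> = (\<Sum>i<N. \<Sum>j<N. \<Sum>l<N. (M $$ (i, j) * M' $$ (j, l)) *\<^sub>C F i l)"
    by simp
  also have "\<dots> = (\<Sum>i<N. \<Sum>l<N. \<Sum>j<N. (M $$ (i, j) * M' $$ (j, l)) *\<^sub>C F i l)"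
    by (intro sum.cong refl sum.swap)
  also have "\<dots> = of_mat (M * M')"
    unfolding of_mat_def
  proof (intro sum.cong refl)
    fix i l assume "i \<in> {..<N}" "l \<in> {..<N}"
    then have "(M * M') $$ (i, l) = (\<Sum>j<N. M $$ (i, j) * M' $$ (j, l))"
      using assms by (auto simp: scalar_prod_def atLeast0LessThan)
    moreover have "(\<Sum>j<N. f j *\<^sub>C F i l) = (\<Sum>j<N. f j) *\<^sub>C F i l" for f
      by (induction N) (simp_all add: scaleC_add_left)
    ultimately show "(\<Sum>j<N. (M $$ (i, j) * M' $$ (j, l)) *\<^sub>C F i l) = (M * M') $$ (i, l) *\<^sub>C F i l"
      by simp
  qed
  finally show ?thesis by simp
qed

lemma of_mat_adjoint:
  assumes "M \<in> carrier_mat N N"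
  shows "of_mat (mat_adjoint M) = star (of_mat M)"
proof -
  have "star (of_mat M) = (\<Sum>i<N. \<Sum>j<N. cnj (M $$ (i, j)) *\<^sub>C F j i)"
    unfolding of_mat_def by (simp add: star_sum star_scaleC unit_star)
  also have "\<dots> = (\<Sum>j<N. \<Sum>i<N. cnj (M $$ (i, j)) *\<^sub>C F j i)"
    by (rule sum.swap)
  also have "\<dots> = of_mat (mat_adjoint M)"
    unfolding of_mat_def by (intro sum.cong refl) (simp add: mat_adjoint_index[OF assms])
  finally show ?thesis by simp
qed

lemma unit_in_span:
  assumes "k < N" "l < N"
  shows "F k l \<in> unit_span"
proof
  let ?M = "mat N N (\<lambda>(i, j). if i = k \<and> j = l then 1 else 0)"
  have "of_mat ?M = (\<Sum>i<N. \<Sum>j<N. if i = k \<and> j = l then F k l else 0)"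
    unfolding of_mat_def by (intro sum.cong refl) (auto simp: scaleC_one)
  also have "\<dots> = (\<Sum>i<N. if i = k then F k l else 0)"
    by (intro sum.cong refl) (auto simp: assms)
  finally show "F k l = of_mat ?M" by (simp add: assms)
qed simp

text \<open>Compression to the diagonal units recovers the coordinates, so the span is cut out by
  closed conditions.\<close>

lemma unit_span_eq:
  "unit_span = {x. x = (\<Sum>i<N. \<Sum>j<N. F i i * x * F j j) \<and>
     (\<forall>i<N. \<forall>j<N. F i i * x * F j j \<in> range (\<lambda>c. c *\<^sub>C F i j))}" (is "_ = ?R")
proof
  show "unit_span \<subseteq> ?R"
    by (auto simp: of_mat_compress) (simp add: of_mat_def)
next
  show "?R \<subseteq> unit_span"
  proof
    fix x assume x: "x \<in> ?R"
    then have "\<forall>i j. \<exists>c. i < N \<and> j < N \<longrightarrow> F i i * x * F j j = c *\<^sub>C F i j"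
      by blast
    then obtain c where "\<And>i j. i < N \<Longrightarrow> j < N \<Longrightarrow> F i i * x * F j j = c i j *\<^sub>C F i j"
      by metis
    moreover from x have "x = (\<Sum>i<N. \<Sum>j<N. F i i * x * F j j)" by blast
    ultimately have "x = (\<Sum>i<N. \<Sum>j<N. c i j *\<^sub>C F i j)"
      by simp
    then have "x = of_mat (mat N N (\<lambda>(i, j). c i j))"
      by (simp add: of_mat_def)
    then show "x \<in> unit_span" by simp
  qed
qed

lemma closed_unit_span: "closed unit_span"
proof -
  have "unit_span = {x. x = (\<Sum>i<N. \<Sum>j<N. F i i * x * F j j)} \<inter>
     (\<Inter>i\<in>{..<N}. \<Inter>j\<in>{..<N}. (\<lambda>x. F i i * x * F j j) -` range (\<lambda>c. c *\<^sub>C F i j))"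
    unfolding unit_span_eq by auto
  moreover have "closed {x. x = (\<Sum>i<N. \<Sum>j<N. F i i * x * F j j)}"
    by (intro closed_Collect_eq continuous_intros)
  moreover have "closed ((\<lambda>x. F i i * x * F j j) -` range (\<lambda>c. c *\<^sub>C F i j))" for i j
    by (intro continuous_closed_vimage closed_range_scaleC continuous_intros)
  ultimately show ?thesis by (auto intro!: closed_Int closed_INT)
qed

lemma cstar_subalgebra_unit_span: "cstar_subalgebra unit_span"
  unfolding cstar_subalgebra_def
proof (intro conjI ballI allI)
  show "closed unit_span" by (rule closed_unit_span)
  show "0 \<in> unit_span"
    by (rule image_eqI[of _ _ "0\<^sub>m N N"]) (simp_all add: of_mat_def)
next
  fix x y assume "x \<in> unit_span" "y \<in> unit_span"
  then obtain M M' where M: "M \<in> carrier_mat N N" "M' \<in> carrier_mat N N"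
    and xy: "x = of_mat M" "y = of_mat M'" by blast
  show "x + y \<in> unit_span"
    unfolding xy of_mat_add[OF M, symmetric] using M by (intro imageI) simp
  show "x * y \<in> unit_span"
    unfolding xy of_mat_mult[OF M, symmetric] using M by (intro imageI) simp
next
  fix c x assume "x \<in> unit_span"
  then obtain M where M: "M \<in> carrier_mat N N" and x: "x = of_mat M" by blast
  show "c *\<^sub>C x \<in> unit_span"
    unfolding x of_mat_smult[OF M, symmetric] using M by (intro imageI) simp
next
  fix x assume "x \<in> unit_span"
  then obtain M where M: "M \<in> carrier_mat N N" and x: "x = of_mat M" by blast
  show "star x \<in> unit_span"
    unfolding x of_mat_adjoint[OF M, symmetric] using mat_adjoint_carrier[OF M] by (rule imageI)
qed

lemma unit_span_subset:
  assumes "cstar_subalgebra C" "\<And>i j. i < N \<Longrightarrow> j < N \<Longrightarrow> F i j \<in> C"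
  shows "unit_span \<subseteq> C"
proof (rule image_subsetI)
  fix M
  have "c *\<^sub>C F i j \<in> C" if "i < N" "j < N" for c i j
    using assms(1) assms(2)[OF that] by (simp add: cstar_subalgebra_def)
  then show "of_mat M \<in> C"
    unfolding of_mat_def by (intro cstar_subalgebra_sum[OF assms(1)]) auto
qed

text \<open>The isomorphism is the inverse of the injective map \<open>of_mat\<close>; each law for
  it is the corresponding law for \<open>of_mat\<close> read backwards.\<close>

theorem cstar_iso_matrix_algebra_unit_span: "cstar_iso_matrix_algebra N unit_span"
  unfolding cstar_iso_matrix_algebra_def
proof (intro conjI exI)
  let ?Phi = "the_inv_into (carrier_mat N N) of_mat"
  note inv = the_inv_into_f_eq[OF inj_on_of_mat]
  show "cstar_subalgebra unit_span" by (rule cstar_subalgebra_unit_span)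
  show "bij_betw ?Phi unit_span (carrier_mat N N)"
    using inj_on_of_mat by (intro bij_betw_the_inv_into) (simp add: bij_betw_def)
  show "\<forall>x\<in>unit_span. \<forall>y\<in>unit_span. ?Phi (x + y) = ?Phi x + ?Phi y"
    by (auto simp: inv intro!: inv of_mat_add)
  show "\<forall>c. \<forall>x\<in>unit_span. ?Phi (c *\<^sub>C x) = c \<cdot>\<^sub>m ?Phi x"
    by (auto simp: inv intro!: inv of_mat_smult)
  show "\<forall>x\<in>unit_span. \<forall>y\<in>unit_span. ?Phi (x * y) = ?Phi x * ?Phi y"
    by (auto simp: inv intro!: inv of_mat_mult)
  show "\<forall>x\<in>unit_span. ?Phi (star x) = mat_adjoint (?Phi x)"
    by (auto simp: inv intro!: inv of_mat_adjoint mat_adjoint_carrier)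
qed

end


section \<open>Matrix units from the monotone rules\<close>

locale monotone_family =
  fixes b :: "int \<Rightarrow> 'a::cstar_algebra"
  assumes rule1: "i \<le> j \<Longrightarrow> b i * b j = 0"
    and rule2: "b i * b j * star (b j) = monotone_coeff i j *\<^sub>C b i"
    and rule3: "star (b i) * b i = b (i - 1) * star (b (i - 1)) - b i * star (b i)"
    and rule4: "b i * star (b i) * b j =
      b j - monotone_coeff i j *\<^sub>C (\<Sum>k\<in>{j<..i}. star (b k) * b k * b j)"
begin

text \<open>In the Fock picture these projections decrease as \<open>i\<close> grows: the
  \<open>i\<close>-th keeps the basis vectors all of whose indices exceed \<open>i\<close>.\<close>

definition range_proj :: "int \<Rightarrow> 'a" where
  "range_proj i = b i * star (b i)"

lemma star_range_proj: "star (range_proj i) = range_proj i"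
  by (simp add: range_proj_def star_mult star_star)

lemma mult_range_proj: "b i * range_proj j = (if j < i then b i else 0)"
  using rule2[of i j] by (simp add: range_proj_def mult.assoc monotone_coeff_def scaleC_one)

lemma range_proj_star: "range_proj j * star (b i) = (if j < i then star (b i) else 0)"
  using arg_cong[OF mult_range_proj[of i j], of star]
  by (simp add: star_mult star_range_proj split: if_splits)

text \<open>For \<open>i \<le> j\<close> the coefficient in rule 4 vanishes and takes the sum with
  it.\<close>

lemma range_proj_mult: "i \<le> j \<Longrightarrow> range_proj i * b j = b j"
  using rule4[of i j] by (simp add: range_proj_def monotone_coeff_def)

lemma range_proj_absorb: "i \<le> j \<Longrightarrow> range_proj i * range_proj j = range_proj j"
  using range_proj_mult[of i j] by (simp add: range_proj_def[of j] mult.assoc[symmetric])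

lemma range_proj_step: "range_proj i + star (b i) * b i = range_proj (i - 1)"
  using rule3[of i] by (simp add: range_proj_def)

text \<open>For \<open>l < k\<close> the projection \<open>range_proj l\<close> can be inserted
  between \<open>b k\<close> and \<open>star (b l)\<close>: the left factor absorbs it, the right
  one is killed by it. Taking adjoints gives the other order.\<close>

lemma mult_star_distinct:
  assumes "i \<noteq> j"
  shows "b i * star (b j) = 0"
proof -
  have lt: "b k * star (b l) = 0" if "l < k" for k l
  proof -
    have "b k * star (b l) = b k * (range_proj l * star (b l))"
      using that by (simp add: mult_range_proj mult.assoc[symmetric])
    then show ?thesis by (simp add: range_proj_star)
  qed
  show ?thesis
  proof (cases "j < i")
    case True
    then show ?thesis by (rule lt)
  next
    case False
    then have "star (b j * star (b i)) = 0" using assms lt[of i j] by simp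
    then show ?thesis by (simp only: star_mult star_star)
  qed
qed

section \<open>Words of creators and their orthogonality\<close>

text \<open>In the Fock picture this word sends the vacuum to the basis vector of a finite set
  \<open>A\<close>. For infinite \<open>A\<close> the default value of
  \<open>sorted_list_of_set\<close> makes it \<open>1\<close>, so finiteness is assumed
  below.\<close>

definition creation :: "int set \<Rightarrow> 'a" where
  "creation A = prod_list (map (\<lambda>i. star (b i)) (sorted_list_of_set A))"

lemma creation_empty [simp]: "creation {} = 1"
  by (simp add: creation_def)

lemma creation_insert:
  assumes "finite A" "\<forall>a\<in>A. i < a"
  shows "creation (insert i A) = star (b i) * creation A"
proof -
  have "i \<notin> A" using assms(2) by auto
  then have "sorted_list_of_set (insert i A) = i # sorted_list_of_set A"
    using assms by (simp add: insort_is_Cons less_imp_le)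
  then show ?thesis by (simp add: creation_def)
qed

text \<open>The first letter of the word has an index above \<open>i\<close> and absorbs
  \<open>range_proj i\<close>. For the empty word the factor \<open>range_proj m\<close> does
  so.\<close>

lemma range_proj_creation:
  assumes "finite A" "\<forall>a\<in>A. i < a" "i \<le> m"
  shows "range_proj i * creation A * range_proj m = creation A * range_proj m"
  using assms
proof (induction rule: finite_linorder_min_induct)
  case empty
  then show ?case by (simp add: range_proj_absorb)
next
  case (insert k A)
  then have "range_proj i * star (b k) = star (b k)" by (simp add: range_proj_star)
  then show ?case
    using insert.hyps by (simp add: creation_insert mult.assoc[symmetric])
qed

text \<open>The first letter has an index at most \<open>m\<close>, and \<open>range_proj m\<close>
  kills it.\<close>

lemma vacuum_creation:
  assumes "finite A" "A \<noteq> {}" "A \<subseteq> {..m}"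
  shows "range_proj m * creation A = 0"
  using assms
proof (induction rule: finite_linorder_min_induct)
  case (insert k A)
  then have "range_proj m * star (b k) = 0" by (simp add: range_proj_star)
  then show ?case
    using insert.hyps by (simp add: creation_insert mult.assoc[symmetric])
qed simp

text \<open>This is the algebraic form of orthonormality of the Fock basis. The least elements of
  \<open>A\<close> and \<open>B\<close> meet in the middle: if they differ the product is zero, and
  if they agree they form a \<open>range_proj\<close> that the rest of the word absorbs, which
  leaves the smaller sets.\<close>

lemma creation_orthogonal:
  assumes "finite A" "A \<subseteq> {..m}" "finite B" "B \<subseteq> {..m}"
  shows "range_proj m * star (creation A) * creation B * range_proj m =
    (if A = B then range_proj m else 0)"
  using assms
proof (induction A arbitrary: B rule: finite_linorder_min_induct)
  case empty
  then show ?case by (auto simp: range_proj_absorb vacuum_creation)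
next
  case (insert i A)
  note A = creation_insert[OF insert.hyps(1,2)]
  \<comment> \<open>The inner induction serves to expose the least element \<open>j\<close> of
    \<open>B\<close>; the outer hypothesis for \<open>A\<close> carries the recursion.\<close>
  from insert.prems(2,3) insert.hyps insert.prems(1) insert.IH show ?case
  proof (induction B rule: finite_linorder_min_induct)
    case empty
    then show ?case
      by (auto simp: A star_mult star_star mult.assoc mult_range_proj)
  next
    case (insert j B)
    have B: "creation (insert j B) = star (b j) * creation B"
      using insert.hyps by (simp add: creation_insert)
    have i: "i \<notin> A" and j: "j \<notin> B" using insert by auto
    show ?case
    proof (cases "i = j")
      case True
      have "range_proj m * star (creation (insert i A)) * creation (insert j B) * range_proj m =
          range_proj m * star (creation A) * (range_proj i * creation B * range_proj m)"
        by (simp add: A[unfolded True] B True star_mult star_star mult.assoc range_proj_def[of j])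
      also have "range_proj i * creation B * range_proj m = creation B * range_proj m"
        using insert.hyps insert.prems(1) True by (intro range_proj_creation) auto
      also have "range_proj m * star (creation A) * (creation B * range_proj m) =
          (if A = B then range_proj m else 0)"
        using insert by (simp add: mult.assoc)
      finally show ?thesis using i j True by auto
    next
      case False
      have "insert i A \<noteq> insert j B"
      proof
        assume eq: "insert i A = insert j B"
        then have "i \<in> insert j B" "j \<in> insert i A" by blast+
        then show False using False insert by fastforce
      qed
      moreover have "range_proj m * star (creation (insert i A)) * creation (insert j B) * range_proj m =
          range_proj m * star (creation A) * (b i * star (b j)) * (creation B * range_proj m)"
        by (simp add: A B star_mult star_star mult.assoc)
      ultimately show ?thesis by (simp add: mult_star_distinct[OF False])
    qed
  qed
qed

section \<open>Fock matrix units and recovery of the generators\<close>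

text \<open>For finite \<open>A\<close> and \<open>B\<close> inside \<open>{..m}\<close>, the Fock
  operator replaces the block \<open>B\<close> by \<open>A\<close> in front of any indices exceeding
  \<open>m\<close>, and kills basis vectors whose indices up to \<open>m\<close> are not exactly
  \<open>B\<close>.\<close>

definition fock_unit :: "int \<Rightarrow> int set \<Rightarrow> int set \<Rightarrow> 'a" where
  "fock_unit m A B = creation A * range_proj m * star (creation B)"

lemma fock_unit_star: "star (fock_unit m A B) = fock_unit m B A"
  by (simp add: fock_unit_def star_mult star_star star_range_proj mult.assoc)

lemma fock_unit_mult:
  assumes "finite B" "B \<subseteq> {..m}" "finite C" "C \<subseteq> {..m}"
  shows "fock_unit m A B * fock_unit m C D = (if B = C then fock_unit m A D else 0)"
proof -
  have "fock_unit m A B * fock_unit m C D =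
      creation A * (range_proj m * star (creation B) * creation C * range_proj m) * star (creation D)"
    by (simp add: fock_unit_def mult.assoc)
  then show ?thesis
    by (simp add: creation_orthogonal[OF assms]) (simp add: fock_unit_def)
qed

text \<open>Off-diagonal units on both sides carry the diagonal unit at \<open>A\<close> to the one
  at \<open>{}\<close>, which is \<open>range_proj m\<close>.\<close>

lemma fock_unit_nonzero:
  assumes "range_proj m \<noteq> 0" "finite A" "A \<subseteq> {..m}"
  shows "fock_unit m A A \<noteq> 0"
proof
  assume "fock_unit m A A = 0"
  then have "fock_unit m {} A * fock_unit m A A * fock_unit m A {} = 0" by simp
  then show False
    using assms by (simp add: fock_unit_mult) (simp add: fock_unit_def)
qed

text \<open>Descending induction from \<open>m\<close>: the subsets that contain the new index
  contribute \<open>star (b i) * range_proj i * b i\<close>, which equals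
  \<open>star (b i) * b i\<close>, the increment in rule 3.\<close>

lemma range_proj_sum_fock_units:
  assumes "i \<le> m"
  shows "(\<Sum>A\<in>Pow {i<..m}. fock_unit m A A) = range_proj i"
  using assms
proof (induction i rule: int_le_induct)
  case base
  then show ?case by (simp add: fock_unit_def)
next
  case (step i)
  \<comment> \<open>The interval is open on the left, so passing from \<open>i\<close> to
    \<open>i - 1\<close> adjoins the index \<open>i\<close>.\<close>
  have ins: "{i - 1<..m} = insert i {i<..m}" using step.hyps by auto
  have unit: "fock_unit m (insert i A) (insert i A) = star (b i) * fock_unit m A A * b i"
    if "A \<in> Pow {i<..m}" for A
  proof -
    have "finite A" "\<forall>a\<in>A. i < a" using that finite_subset by auto
    then show ?thesis
      by (simp add: fock_unit_def creation_insert star_mult star_star mult.assoc)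
  qed
  have "(\<Sum>A\<in>Pow {i - 1<..m}. fock_unit m A A) =
      (\<Sum>A\<in>Pow {i<..m}. fock_unit m A A) + (\<Sum>A\<in>insert i ` Pow {i<..m}. fock_unit m A A)"
    unfolding ins Pow_insert by (rule sum.union_disjoint) auto
  also have "(\<Sum>A\<in>insert i ` Pow {i<..m}. fock_unit m A A) =
      (\<Sum>A\<in>Pow {i<..m}. fock_unit m (insert i A) (insert i A))"
  proof (rule sum.reindex_cong)
    show "inj_on (insert i) (Pow {i<..m})"
      by (rule inj_onI) (auto dest!: insert_ident[THEN iffD1, rotated 2])
  qed auto
  also have "\<dots> = star (b i) * (\<Sum>A\<in>Pow {i<..m}. fock_unit m A A) * b i"
    by (simp add: unit sum_distrib_left sum_distrib_right)
  also have "\<dots> = star (b i) * b i"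
    by (simp add: step.IH range_proj_mult mult.assoc)
  finally show ?case by (simp add: step.IH range_proj_step)
qed

text \<open>Since \<open>range_proj i\<close> fixes \<open>b i\<close>, the sum of diagonal units
  can be put in front of it. Each \<open>star (creation A)\<close> then swallows \<open>b i\<close>
  and becomes the adjoint of a word one letter longer.\<close>

lemma generator_sum_fock_units:
  assumes "i \<le> m"
  shows "b i = (\<Sum>A\<in>Pow {i<..m}. fock_unit m A (insert i A))"
proof -
  have "b i = (\<Sum>A\<in>Pow {i<..m}. fock_unit m A A) * b i"
    using assms by (simp add: range_proj_sum_fock_units range_proj_mult)
  also have "\<dots> = (\<Sum>A\<in>Pow {i<..m}. fock_unit m A (insert i A))"
    unfolding sum_distrib_right
  proof (rule sum.cong)
    fix A assume "A \<in> Pow {i<..m}"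
    then have "finite A" "\<forall>a\<in>A. i < a" using finite_subset by auto
    then show "fock_unit m A A * b i = fock_unit m A (insert i A)"
      by (simp add: fock_unit_def creation_insert star_mult star_star mult.assoc)
  qed simp
  finally show ?thesis .
qed

text \<open>The factor \<open>x\<close> is carried along because \<open>C\<close> may lack
  \<open>1\<close>, which is the value of the empty word.\<close>

lemma creation_mult_mem:
  assumes "cstar_subalgebra C" "x \<in> C" "finite A" "\<And>i. i \<in> A \<Longrightarrow> b i \<in> C"
  shows "creation A * x \<in> C"
  using assms(3,4)
proof (induction rule: finite_linorder_min_induct)
  case empty
  then show ?case using assms(2) by simp
next
  case (insert i A)
  then show ?case
    using assms(1) by (simp add: creation_insert cstar_subalgebra_def mult.assoc)
qed

text \<open>The word on the right is reached by taking adjoints, multiplying on the left, and taking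
  adjoints again.\<close>

lemma fock_unit_mem:
  assumes "cstar_subalgebra C" "b m \<in> C" "finite A" "finite B" "\<And>i. i \<in> A \<union> B \<Longrightarrow> b i \<in> C"
  shows "fock_unit m A B \<in> C"
proof -
  have "range_proj m \<in> C"
    using assms(1,2) by (simp add: range_proj_def cstar_subalgebra_def)
  with assms have "creation A * range_proj m \<in> C"
    by (intro creation_mult_mem) auto
  then have "star (creation A * range_proj m) \<in> C"
    using assms(1) by (simp add: cstar_subalgebra_def)
  then have "creation B * star (creation A * range_proj m) \<in> C"
    using assms by (intro creation_mult_mem) auto
  then have "star (creation B * star (creation A * range_proj m)) \<in> C"
    using assms(1) by (simp add: cstar_subalgebra_def)
  then show ?thesis
    by (simp add: fock_unit_def star_mult star_star)
qed

theorem cstar_generated_interval_iso: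
  assumes nz: "range_proj m \<noteq> 0" and lm: "l \<le> m"
  shows "cstar_iso_matrix_algebra (2 ^ card {l..m}) (cstar_generated (b ` {l..m}))"
proof -
  let ?I = "{l..m}" and ?N = "2 ^ card {l..m} :: nat"
  \<comment> \<open>The units are indexed by subsets of the interval; \<open>h\<close> numbers these
    subsets so that they become row and column indices.\<close>
  have "\<exists>h. bij_betw h {0..<card (Pow ?I)} (Pow ?I)"
    by (intro ex_bij_betw_nat_finite) simp
  then obtain h where h: "bij_betw h {..<?N} (Pow ?I)"
    by (auto simp: card_Pow atLeast0LessThan)
  have sub: "h i \<subseteq> ?I" if "i < ?N" for i
    using bij_betwE[OF h] that by auto
  have le: "h i \<subseteq> {..m}" and fin: "finite (h i)" if "i < ?N" for i
    using sub[OF that] finite_subset by auto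
  have h_eq: "h i = h j \<longleftrightarrow> i = j" if "i < ?N" "j < ?N" for i j
    using h that by (auto simp: bij_betw_def inj_on_def)
  define F where "F i j = fock_unit m (h i) (h j)" for i j
  interpret cstar_matrix_units ?N F
    by unfold_locales
      (simp_all add: F_def fock_unit_mult fock_unit_star fock_unit_nonzero nz fin le h_eq)
  have unit: "fock_unit m A B \<in> unit_span" if "A \<subseteq> ?I" "B \<subseteq> ?I" for A B
  proof -
    have "A \<in> h ` {..<?N}" "B \<in> h ` {..<?N}"
      using h that by (auto simp: bij_betw_def)
    then show ?thesis using unit_in_span by (auto simp: F_def)
  qed
  have "cstar_generated (b ` ?I) = unit_span"
  proof
    show "cstar_generated (b ` ?I) \<subseteq> unit_span"
    proof (rule cstar_generated_least[OF cstar_subalgebra_unit_span], rule image_subsetI)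
      fix i assume i: "i \<in> ?I"
      then have "b i = (\<Sum>A\<in>Pow {i<..m}. fock_unit m A (insert i A))"
        by (intro generator_sum_fock_units) simp
      also have "\<dots> \<in> unit_span"
        using i by (intro cstar_subalgebra_sum[OF cstar_subalgebra_unit_span] unit) auto
      finally show "b i \<in> unit_span" .
    qed
    show "unit_span \<subseteq> cstar_generated (b ` ?I)"
    proof (rule unit_span_subset[OF cstar_subalgebra_generated])
      fix i j assume ij: "i < ?N" "j < ?N"
      have "b k \<in> cstar_generated (b ` ?I)" if "k \<in> ?I" for k
        using that cstar_generated_superset by blast
      \<comment> \<open>By \<open>lm\<close> the index \<open>m\<close> lies in the interval, so the
        algebra contains \<open>b m\<close> and the projection in the middle of each unit.\<close>
      then show "F i j \<in> cstar_generated (b ` ?I)"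
        unfolding F_def using lm sub[OF ij(1)] sub[OF ij(2)] fin[OF ij(1)] fin[OF ij(2)]
        by (intro fock_unit_mem[OF cstar_subalgebra_generated]) auto
    qed
  qed
  then show ?thesis using cstar_iso_matrix_algebra_unit_span by simp
qed

end


section \<open>The Fock seminorm\<close>

definition fin_supp :: "('k \<Rightarrow> complex) \<Rightarrow> bool" where
  "fin_supp f \<longleftrightarrow> finite {x. f x \<noteq> 0}"

text \<open>Conjugate-linear in the first argument. Summing over the support of \<open>f\<close>
  alone makes linearity in \<open>g\<close> immediate.\<close>

definition inner_l2 :: "('k \<Rightarrow> complex) \<Rightarrow> ('k \<Rightarrow> complex) \<Rightarrow> complex" where
  "inner_l2 f g = (\<Sum>x | f x \<noteq> 0. cnj (f x) * g x)"

definition norm_l2 :: "('k \<Rightarrow> complex) \<Rightarrow> real" where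
  "norm_l2 f = L2_set (\<lambda>x. cmod (f x)) {x. f x \<noteq> 0}"

lemma inner_l2_superset:
  assumes "finite S" "{x. f x \<noteq> 0} \<subseteq> S"
  shows "inner_l2 f g = (\<Sum>x\<in>S. cnj (f x) * g x)"
  unfolding inner_l2_def using assms by (intro sum.mono_neutral_left) auto

lemma norm_l2_superset:
  assumes "finite S" "{x. f x \<noteq> 0} \<subseteq> S"
  shows "norm_l2 f = L2_set (\<lambda>x. cmod (f x)) S"
  unfolding norm_l2_def L2_set_def using assms
  by (intro arg_cong[where f = sqrt] sum.mono_neutral_left) auto

lemma fin_supp_add: "fin_supp f \<Longrightarrow> fin_supp g \<Longrightarrow> fin_supp (\<lambda>x. f x + g x)"
  unfolding fin_supp_def by (rule finite_subset[of _ "{x. f x \<noteq> 0} \<union> {x. g x \<noteq> 0}"]) auto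

lemma fin_supp_scale: "fin_supp f \<Longrightarrow> fin_supp (\<lambda>x. c * f x)"
  unfolding fin_supp_def by (rule finite_subset[of _ "{x. f x \<noteq> 0}"]) auto

lemma norm_l2_nonneg [simp]: "0 \<le> norm_l2 f"
  by (simp add: norm_l2_def)

lemma norm_l2_zero [simp]: "norm_l2 (\<lambda>x. 0) = 0"
  by (simp add: norm_l2_def)

lemma norm_l2_triangle:
  assumes "fin_supp f" "fin_supp g"
  shows "norm_l2 (\<lambda>x. f x + g x) \<le> norm_l2 f + norm_l2 g"
proof -
  let ?S = "{x. f x \<noteq> 0} \<union> {x. g x \<noteq> 0}"
  have S: "finite ?S" using assms by (simp add: fin_supp_def)
  have "norm_l2 (\<lambda>x. f x + g x) = L2_set (\<lambda>x. cmod (f x + g x)) ?S"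
    by (rule norm_l2_superset[OF S]) auto
  also have "\<dots> \<le> L2_set (\<lambda>x. cmod (f x) + cmod (g x)) ?S"
    by (rule L2_set_mono) (auto intro: norm_triangle_ineq)
  also have "\<dots> \<le> L2_set (\<lambda>x. cmod (f x)) ?S + L2_set (\<lambda>x. cmod (g x)) ?S"
    by (rule L2_set_triangle_ineq)
  also have "\<dots> = norm_l2 f + norm_l2 g"
    using norm_l2_superset[OF S, of f] norm_l2_superset[OF S, of g] by auto
  finally show ?thesis .
qed

lemma norm_l2_scale:
  assumes "fin_supp f"
  shows "norm_l2 (\<lambda>x. c * f x) = cmod c * norm_l2 f"
proof -
  have "norm_l2 (\<lambda>x. c * f x) = L2_set (\<lambda>x. cmod (c * f x)) {x. f x \<noteq> 0}"
    using assms by (intro norm_l2_superset) (auto simp: fin_supp_def)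
  then show ?thesis by (simp add: norm_mult L2_set_right_distrib norm_l2_def)
qed

lemma inner_l2_self: "inner_l2 f f = of_real ((norm_l2 f)\<^sup>2)"
proof -
  have "cnj z * z = of_real ((cmod z)\<^sup>2)" for z
    by (metis complex_norm_square mult.commute)
  then show ?thesis
    by (simp add: inner_l2_def norm_l2_def L2_set_def sum_nonneg real_sqrt_pow2)
qed

lemma inner_l2_commute:
  assumes "fin_supp f" "fin_supp g"
  shows "inner_l2 g f = cnj (inner_l2 f g)"
proof -
  let ?S = "{x. f x \<noteq> 0} \<union> {x. g x \<noteq> 0}"
  have S: "finite ?S" using assms by (simp add: fin_supp_def)
  show ?thesis
    using inner_l2_superset[OF S, of f g] inner_l2_superset[OF S, of g f]
    by (simp add: mult.commute)
qed

lemma inner_l2_Cauchy_Schwarz: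
  assumes "fin_supp f" "fin_supp g"
  shows "cmod (inner_l2 f g) \<le> norm_l2 f * norm_l2 g"
proof -
  let ?S = "{x. f x \<noteq> 0} \<union> {x. g x \<noteq> 0}"
  have S: "finite ?S" using assms by (simp add: fin_supp_def)
  have "cmod (inner_l2 f g) = cmod (\<Sum>x\<in>?S. cnj (f x) * g x)"
    by (subst inner_l2_superset[OF S]) auto
  also have "\<dots> \<le> (\<Sum>x\<in>?S. \<bar>cmod (f x)\<bar> * \<bar>cmod (g x)\<bar>)"
    by (rule sum_norm_le) (simp add: norm_mult)
  also have "\<dots> \<le> L2_set (\<lambda>x. cmod (f x)) ?S * L2_set (\<lambda>x. cmod (g x)) ?S"
    by (rule L2_set_mult_ineq)
  also have "\<dots> = norm_l2 f * norm_l2 g"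
    using norm_l2_superset[OF S, of f] norm_l2_superset[OF S, of g] by auto
  finally show ?thesis .
qed

lemma inner_l2_add_left:
  assumes "fin_supp f" "fin_supp g"
  shows "inner_l2 (\<lambda>x. f x + g x) h = inner_l2 f h + inner_l2 g h"
proof -
  let ?S = "{x. f x \<noteq> 0} \<union> {x. g x \<noteq> 0}"
  have S: "finite ?S" using assms by (simp add: fin_supp_def)
  have "inner_l2 (\<lambda>x. f x + g x) h = (\<Sum>x\<in>?S. cnj (f x + g x) * h x)"
    by (rule inner_l2_superset[OF S]) auto
  then show ?thesis
    using inner_l2_superset[OF S, of f h] inner_l2_superset[OF S, of g h]
    by (simp add: distrib_right sum.distrib)
qed

lemma inner_l2_scale_left:
  assumes "fin_supp f"
  shows "inner_l2 (\<lambda>x. c * f x) h = cnj c * inner_l2 f h"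
proof -
  have "inner_l2 (\<lambda>x. c * f x) h = (\<Sum>x | f x \<noteq> 0. cnj (c * f x) * h x)"
    using assms by (intro inner_l2_superset) (auto simp: fin_supp_def)
  then show ?thesis by (simp add: inner_l2_def sum_distrib_left mult.assoc)
qed

lemma inner_l2_add_right: "inner_l2 h (\<lambda>x. f x + g x) = inner_l2 h f + inner_l2 h g"
  by (simp add: inner_l2_def distrib_left sum.distrib)

lemma inner_l2_scale_right: "inner_l2 h (\<lambda>x. c * f x) = c * inner_l2 h f"
  by (simp add: inner_l2_def sum_distrib_left mult_ac)

section \<open>Annihilation and creation operators\<close>

text \<open>Basis vectors are indexed by arbitrary sets of integers. The infinite ones do no harm:
  the rules hold on them as well, and no finiteness has to be tracked.\<close>

definition annihilate :: "int \<Rightarrow> (int set \<Rightarrow> complex) \<Rightarrow> int set \<Rightarrow> complex" where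
  "annihilate i f A = (if \<forall>a\<in>A. i < a then f (insert i A) else 0)"

definition create :: "int \<Rightarrow> (int set \<Rightarrow> complex) \<Rightarrow> int set \<Rightarrow> complex" where
  "create i f A = (if i \<in> A \<and> (\<forall>a\<in>A. i \<le> a) then f (A - {i}) else 0)"

text \<open>The operator reads the coefficients of \<open>f\<close> along \<open>insert i\<close>,
  which is injective on sets avoiding \<open>i\<close>. Finite support, contractivity and the
  adjoint relation all come from this reindexing.\<close>

lemma supp_annihilate:
  "insert i ` {A. annihilate i f A \<noteq> 0} \<subseteq> {A. f A \<noteq> 0}"
  "inj_on (insert i) {A. annihilate i f A \<noteq> 0}"
proof -
  show "insert i ` {A. annihilate i f A \<noteq> 0} \<subseteq> {A. f A \<noteq> 0}"
    by (auto simp: annihilate_def split: if_splits)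
  show "inj_on (insert i) {A. annihilate i f A \<noteq> 0}"
  proof (rule inj_onI)
    fix A B assume "A \<in> {A. annihilate i f A \<noteq> 0}" "B \<in> {A. annihilate i f A \<noteq> 0}"
    then have "i \<notin> A" "i \<notin> B" by (auto simp: annihilate_def split: if_splits)
    then show "insert i A = insert i B \<Longrightarrow> A = B" by (simp add: insert_ident)
  qed
qed

lemma supp_create:
  "(\<lambda>A. A - {i}) ` {A. create i f A \<noteq> 0} \<subseteq> {A. f A \<noteq> 0}"
  "inj_on (\<lambda>A. A - {i}) {A. create i f A \<noteq> 0}"
proof -
  show "(\<lambda>A. A - {i}) ` {A. create i f A \<noteq> 0} \<subseteq> {A. f A \<noteq> 0}"
    by (auto simp: create_def split: if_splits)
  show "inj_on (\<lambda>A. A - {i}) {A. create i f A \<noteq> 0}"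
  proof (rule inj_onI)
    fix A B assume "A \<in> {A. create i f A \<noteq> 0}" "B \<in> {A. create i f A \<noteq> 0}"
    then have "i \<in> A" "i \<in> B" by (auto simp: create_def split: if_splits)
    then show "A - {i} = B - {i} \<Longrightarrow> A = B" by blast
  qed
qed

lemma fin_supp_annihilate: "fin_supp f \<Longrightarrow> fin_supp (annihilate i f)"
  using supp_annihilate[of i f] by (auto simp: fin_supp_def intro: inj_on_finite)

lemma fin_supp_create: "fin_supp f \<Longrightarrow> fin_supp (create i f)"
  using supp_create[of i f] by (auto simp: fin_supp_def intro: inj_on_finite)

text \<open>The nonzero coefficients of \<open>g\<close> are coefficients of \<open>f\<close> at
  distinct places, so their squares form part of the sum for \<open>f\<close>.\<close>

lemma norm_l2_reindex_le:
  assumes f: "fin_supp f" and t: "inj_on t {A. g A \<noteq> 0}" "t ` {A. g A \<noteq> 0} \<subseteq> {A. f A \<noteq> 0}"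
    and fg: "\<And>A. g A \<noteq> 0 \<Longrightarrow> g A = f (t A)"
  shows "norm_l2 g \<le> norm_l2 f"
proof -
  have "(\<Sum>A | g A \<noteq> 0. (cmod (g A))\<^sup>2) = (\<Sum>A\<in>t ` {A. g A \<noteq> 0}. (cmod (f A))\<^sup>2)"
    using fg by (simp add: sum.reindex[OF t(1)])
  also have "\<dots> \<le> (\<Sum>A | f A \<noteq> 0. (cmod (f A))\<^sup>2)"
    using f t(2) by (intro sum_mono2) (auto simp: fin_supp_def)
  finally show ?thesis by (simp add: norm_l2_def L2_set_def)
qed

lemma norm_l2_annihilate: "fin_supp f \<Longrightarrow> norm_l2 (annihilate i f) \<le> norm_l2 f"
  by (rule norm_l2_reindex_le[where t = "insert i"])
    (use supp_annihilate in \<open>auto simp: annihilate_def split: if_splits\<close>)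

lemma norm_l2_create: "fin_supp f \<Longrightarrow> norm_l2 (create i f) \<le> norm_l2 f"
  by (rule norm_l2_reindex_le[where t = "\<lambda>A. A - {i}"])
    (use supp_create in \<open>auto simp: create_def split: if_splits\<close>)

lemma annihilate_adjoint:
  assumes "fin_supp f"
  shows "inner_l2 (annihilate i f) g = inner_l2 f (create i g)"
proof -
  let ?S = "{A. annihilate i f A \<noteq> 0}"
  have "inner_l2 (annihilate i f) g = (\<Sum>A\<in>?S. cnj (f (insert i A)) * create i g (insert i A))"
    unfolding inner_l2_def
  proof (rule sum.cong)
    fix A assume "A \<in> ?S"
    then have less: "\<forall>a\<in>A. i < a" by (auto simp: annihilate_def split: if_splits)
    then have "insert i A - {i} = A" by auto
    then show "cnj (annihilate i f A) * g A = cnj (f (insert i A)) * create i g (insert i A)"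
      using less by (auto simp: annihilate_def create_def less_imp_le)
  qed simp
  also have "\<dots> = (\<Sum>A\<in>insert i ` ?S. cnj (f A) * create i g A)"
    by (simp add: sum.reindex[OF supp_annihilate(2)])
  also have "\<dots> = inner_l2 f (create i g)"
    unfolding inner_l2_def
  proof (rule sum.mono_neutral_left)
    show "finite {A. f A \<noteq> 0}" using assms by (simp add: fin_supp_def)
    show "insert i ` ?S \<subseteq> {A. f A \<noteq> 0}" by (rule supp_annihilate)
    \<comment> \<open>If \<open>i\<close> were the least element of such an \<open>A\<close>, then
      \<open>A\<close> would be the image of \<open>A - {i}\<close>; hence \<open>create i g\<close>
      vanishes there.\<close>
    show "\<forall>A\<in>{A. f A \<noteq> 0} - insert i ` ?S. cnj (f A) * create i g A = 0"
    proof
      fix A assume A: "A \<in> {A. f A \<noteq> 0} - insert i ` ?S"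
      have "A - {i} \<in> ?S" if "i \<in> A" "\<forall>a\<in>A. i \<le> a"
      proof -
        have "insert i (A - {i}) = A" using that by blast
        then show ?thesis using that A by (auto simp: annihilate_def order.strict_iff_order)
      qed
      then have "A \<in> insert i ` ?S" if "i \<in> A" "\<forall>a\<in>A. i \<le> a"
        using that by (metis image_eqI insert_Diff)
      with A show "cnj (f A) * create i g A = 0" by (auto simp: create_def)
    qed
  qed
  finally show ?thesis .
qed

lemma create_adjoint:
  assumes "fin_supp f" "fin_supp g"
  shows "inner_l2 (create i f) g = inner_l2 f (annihilate i g)"
  using annihilate_adjoint[OF assms(2), of i f] assms
  by (metis fin_supp_annihilate fin_supp_create inner_l2_commute)

section \<open>The Fock representation of the free *-algebra\<close>

definition letter_op :: "int \<times> bool \<Rightarrow> (int set \<Rightarrow> complex) \<Rightarrow> int set \<Rightarrow> complex" where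
  "letter_op x = (if snd x then create (fst x) else annihilate (fst x))"

fun word_op :: "int word \<Rightarrow> (int set \<Rightarrow> complex) \<Rightarrow> int set \<Rightarrow> complex" where
  "word_op (Word u) f = foldr letter_op u f"

text \<open>The linear extension is written out pointwise because \<open>free_eval\<close> asks for
  values in a type of class \<open>star_algebra\<close>, whereas the values here are maps on
  functions.\<close>

definition fock_rep :: "int free_star_algebra \<Rightarrow> (int set \<Rightarrow> complex) \<Rightarrow> int set \<Rightarrow> complex" where
  "fock_rep x f A = (\<Sum>w\<in>Poly_Mapping.keys x. Poly_Mapping.lookup x w * word_op w f A)"

lemma word_op_plus: "word_op (u + v) f = word_op u (word_op v f)"
  by (cases u; cases v) simp

lemma word_op_add: "word_op w (\<lambda>A. f A + g A) = (\<lambda>A. word_op w f A + word_op w g A)"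
proof (cases w)
  case (Word u)
  have letter: "letter_op x (\<lambda>A. f A + g A) = (\<lambda>A. letter_op x f A + letter_op x g A)" for x f g
    by (auto simp: letter_op_def annihilate_def create_def)
  show ?thesis unfolding Word by (induction u) (simp_all add: letter)
qed

lemma word_op_scale: "word_op w (\<lambda>A. c * f A) = (\<lambda>A. c * word_op w f A)"
proof (cases w)
  case (Word u)
  have letter: "letter_op x (\<lambda>A. c * f A) = (\<lambda>A. c * letter_op x f A)" for x f
    by (auto simp: letter_op_def annihilate_def create_def)
  show ?thesis unfolding Word by (induction u) (simp_all add: letter)
qed

lemma word_op_contraction:
  assumes "fin_supp f"
  shows "fin_supp (word_op w f)" "norm_l2 (word_op w f) \<le> norm_l2 f"
proof -
  obtain u where w: "w = Word u" by (cases w)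
  have "fin_supp (word_op w f) \<and> norm_l2 (word_op w f) \<le> norm_l2 f"
    unfolding w
  proof (induction u)
    case (Cons x u)
    then have "fin_supp (letter_op x (foldr letter_op u f))"
      "norm_l2 (letter_op x (foldr letter_op u f)) \<le> norm_l2 (foldr letter_op u f)"
      by (simp_all add: letter_op_def fin_supp_annihilate fin_supp_create norm_l2_annihilate
          norm_l2_create)
    with Cons show ?case by simp
  qed (simp add: assms)
  then show "fin_supp (word_op w f)" "norm_l2 (word_op w f) \<le> norm_l2 f" by simp_all
qed

text \<open>Letters cross to the other side one at a time, flipped and in reverse order, as in
  \<open>star\<close> on words; \<open>g\<close> changes on the way and is generalized.\<close>

lemma word_op_adjoint:
  assumes "fin_supp f" "fin_supp g"
  shows "inner_l2 (word_op w f) g = inner_l2 f (word_op (star w) g)"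
proof (cases w)
  case (Word u)
  show ?thesis unfolding Word using assms(2)
  proof (induction u arbitrary: g)
    case (Cons x u)
    obtain i s where x: "x = (i, s)" by (cases x)
    have fu: "fin_supp (foldr letter_op u f)"
      using word_op_contraction(1)[OF assms(1), of "Word u"] by simp
    have fx: "fin_supp (letter_op (i, \<not> s) g)"
      using Cons.prems by (simp add: letter_op_def fin_supp_annihilate fin_supp_create)
    have "inner_l2 (letter_op x (foldr letter_op u f)) g =
        inner_l2 (foldr letter_op u f) (letter_op (i, \<not> s) g)"
      using fu Cons.prems by (simp add: x letter_op_def annihilate_adjoint create_adjoint)
    then show ?case using Cons.IH[OF fx] by (simp add: x)
  qed simp
qed

lemma fock_rep_superset:
  assumes "finite S" "Poly_Mapping.keys x \<subseteq> S"
  shows "fock_rep x f A = (\<Sum>w\<in>S. Poly_Mapping.lookup x w * word_op w f A)"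
  unfolding fock_rep_def using assms
  by (intro sum.mono_neutral_left) (auto simp: in_keys_iff)

lemma fock_rep_single: "fock_rep (Poly_Mapping.single w c) f = (\<lambda>A. c * word_op w f A)"
proof
  show "fock_rep (Poly_Mapping.single w c) f A = c * word_op w f A" for A
    by (subst fock_rep_superset[of "{w}"]) auto
qed

lemma fock_rep_zero: "fock_rep 0 f = (\<lambda>A. 0)"
  by (rule ext) (simp add: fock_rep_def)

lemma fock_rep_add: "fock_rep (x + y) f = (\<lambda>A. fock_rep x f A + fock_rep y f A)"
proof
  fix A
  let ?S = "Poly_Mapping.keys x \<union> Poly_Mapping.keys y"
  have "Poly_Mapping.keys (x + y) \<subseteq> ?S" by (rule Poly_Mapping.keys_add)
  then show "fock_rep (x + y) f A = fock_rep x f A + fock_rep y f A"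
    by (simp add: fock_rep_superset[of ?S] lookup_add distrib_right sum.distrib)
qed

lemma fock_rep_scaleC: "fock_rep (c *\<^sub>C x) f = (\<lambda>A. c * fock_rep x f A)"
  by (induction x rule: poly_mapping_add_induct)
    (simp_all add: fock_rep_zero fock_rep_single fock_rep_add scaleC_add_right scaleC_single
      scaleC_complex_def distrib_left mult.assoc)

lemma fock_rep_minus: "fock_rep (- x) f = (\<lambda>A. - fock_rep x f A)"
  using fock_rep_scaleC[of "-1" x f] by (simp add: scaleC_minus_one)

lemma fock_rep_diff: "fock_rep (x - y) f = (\<lambda>A. fock_rep x f A - fock_rep y f A)"
  using fock_rep_add[of x "- y" f] by (simp add: fock_rep_minus)

lemma fock_rep_sum: "fock_rep (sum h K) f = (\<lambda>A. \<Sum>k\<in>K. fock_rep (h k) f A)"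
  by (induction K rule: infinite_finite_induct) (simp_all add: fock_rep_zero fock_rep_add)

lemma fock_rep_add_right:
  "fock_rep x (\<lambda>A. f A + g A) = (\<lambda>A. fock_rep x f A + fock_rep x g A)"
  by (rule ext) (simp add: fock_rep_def word_op_add distrib_left sum.distrib)

lemma fock_rep_zero_right: "fock_rep x (\<lambda>A. 0) = (\<lambda>A. 0)"
  using word_op_scale[of _ 0 "\<lambda>A. 0"] by (intro ext) (simp add: fock_rep_def)

lemma fock_rep_mult: "fock_rep (x * y) f = fock_rep x (fock_rep y f)"
proof (induction x rule: poly_mapping_add_induct)
  case (single k a)
  show ?case
    by (induction y rule: poly_mapping_add_induct)
      (simp_all add: fock_rep_zero fock_rep_zero_right fock_rep_single fock_rep_add
        fock_rep_add_right mult_single word_op_plus word_op_scale word_op_add distrib_left mult.assoc)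
qed (simp_all add: fock_rep_zero fock_rep_add distrib_right)

lemma fock_rep_gen: "fock_rep (free_gen i) f = annihilate i f"
  by (simp add: free_gen_def fock_rep_single letter_op_def)

lemma fock_rep_star_gen: "fock_rep (star (free_gen i)) f = create i f"
  by (simp add: free_gen_def star_single star_complex_def fock_rep_single letter_op_def)

lemma fin_supp_fock_rep: "fin_supp f \<Longrightarrow> fin_supp (fock_rep x f)"
proof (induction x rule: poly_mapping_add_induct)
  case zero
  then show ?case by (simp add: fock_rep_zero fin_supp_def)
next
  case (single k c)
  then show ?case by (simp add: fock_rep_single fin_supp_scale word_op_contraction)
next
  case (add x y)
  then show ?case by (simp add: fock_rep_add fin_supp_add)
qed

lemma fock_rep_adjoint:
  assumes "fin_supp f" "fin_supp g"
  shows "inner_l2 (fock_rep x f) g = inner_l2 f (fock_rep (star x) g)"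
proof (induction x rule: poly_mapping_add_induct)
  case zero
  then show ?case by (simp add: fock_rep_zero inner_l2_def)
next
  case (single k c)
  then show ?case
    by (simp add: fock_rep_single star_single star_complex_def inner_l2_scale_left
        inner_l2_scale_right word_op_contraction word_op_adjoint assms)
next
  case (add x y)
  then show ?case
    by (simp add: fock_rep_add star_add inner_l2_add_left inner_l2_add_right fin_supp_fock_rep assms)
qed

text \<open>Words act as contractions, so the moduli of the coefficients add up to a bound. This
  makes the set of bounds behind the operator seminorm nonempty.\<close>

lemma fock_rep_bounded: "\<exists>K\<ge>0. \<forall>f. fin_supp f \<longrightarrow> norm_l2 (fock_rep x f) \<le> K * norm_l2 f"
proof (induction x rule: poly_mapping_add_induct)
  case zero
  then show ?case by (intro exI[of _ 0]) (simp add: fock_rep_zero)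
next
  case (single k c)
  then show ?case
    by (intro exI[of _ "cmod c"])
      (simp add: fock_rep_single norm_l2_scale word_op_contraction mult_left_mono)
next
  case (add x y)
  then obtain K L where K: "K \<ge> 0" "\<And>f. fin_supp f \<Longrightarrow> norm_l2 (fock_rep x f) \<le> K * norm_l2 f"
    and L: "L \<ge> 0" "\<And>f. fin_supp f \<Longrightarrow> norm_l2 (fock_rep y f) \<le> L * norm_l2 f"
    by blast
  have "norm_l2 (fock_rep (x + y) f) \<le> (K + L) * norm_l2 f" if f: "fin_supp f" for f
    using norm_l2_triangle[OF fin_supp_fock_rep[OF f, of x] fin_supp_fock_rep[OF f, of y]]
      K(2)[OF f] L(2)[OF f]
    by (simp add: fock_rep_add distrib_right)
  then show ?case using K(1) L(1) by (intro exI[of _ "K + L"]) simp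
qed

section \<open>The operator seminorm\<close>

text \<open>The operator norm on the finitely supported vectors. No completion is needed, because
  Cauchy-Schwarz and the existence of adjoints already give the C*-identity.\<close>

definition fock_seminorm :: "int free_star_algebra \<Rightarrow> real" where
  "fock_seminorm x = Inf {K. 0 \<le> K \<and> (\<forall>f. fin_supp f \<longrightarrow> norm_l2 (fock_rep x f) \<le> K * norm_l2 f)}"

lemma fock_seminorm_nonneg: "0 \<le> fock_seminorm x"
  unfolding fock_seminorm_def using fock_rep_bounded[of x] by (intro cInf_greatest) auto

lemma fock_seminorm_le:
  assumes "0 \<le> K" "\<And>f. fin_supp f \<Longrightarrow> norm_l2 (fock_rep x f) \<le> K * norm_l2 f"
  shows "fock_seminorm x \<le> K"
  unfolding fock_seminorm_def using assms by (intro cInf_lower) (auto intro: bdd_belowI)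

text \<open>The infimum is itself an admissible bound: the quotient of the norms lies below every
  bound when \<open>f\<close> has positive norm, and any bound settles the case of norm
  zero.\<close>

lemma fock_rep_le:
  assumes f: "fin_supp f"
  shows "norm_l2 (fock_rep x f) \<le> fock_seminorm x * norm_l2 f"
proof (cases "norm_l2 f = 0")
  case True
  then show ?thesis using fock_rep_bounded[of x] f by force
next
  case False
  then have pos: "norm_l2 f > 0" using norm_l2_nonneg[of f] by linarith
  have "norm_l2 (fock_rep x f) / norm_l2 f \<le> fock_seminorm x"
    unfolding fock_seminorm_def using fock_rep_bounded[of x] f pos
    by (intro cInf_greatest) (auto simp: divide_le_eq)
  then show ?thesis using pos by (simp add: divide_le_eq)
qed

lemma fock_seminorm_mult: "fock_seminorm (x * y) \<le> fock_seminorm x * fock_seminorm y"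
proof (rule fock_seminorm_le)
  fix f :: "int set \<Rightarrow> complex" assume f: "fin_supp f"
  have "norm_l2 (fock_rep (x * y) f) \<le> fock_seminorm x * norm_l2 (fock_rep y f)"
    by (simp add: fock_rep_mult fock_rep_le fin_supp_fock_rep f)
  also have "\<dots> \<le> fock_seminorm x * (fock_seminorm y * norm_l2 f)"
    by (intro mult_left_mono fock_rep_le f fock_seminorm_nonneg)
  finally show "norm_l2 (fock_rep (x * y) f) \<le> fock_seminorm x * fock_seminorm y * norm_l2 f"
    by (simp add: mult.assoc)
qed (simp add: fock_seminorm_nonneg)

text \<open>The squared norm of \<open>fock_rep x f\<close> is the inner product of \<open>f\<close>
  with \<open>fock_rep (star x * x) f\<close>, so Cauchy-Schwarz makes the square root of the right
  side a bound for \<open>x\<close>.\<close>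

lemma fock_seminorm_power2_le: "(fock_seminorm x)\<^sup>2 \<le> fock_seminorm (star x * x)"
proof -
  have "fock_seminorm x \<le> sqrt (fock_seminorm (star x * x))"
  proof (rule fock_seminorm_le)
    fix f :: "int set \<Rightarrow> complex" assume f: "fin_supp f"
    have "(norm_l2 (fock_rep x f))\<^sup>2 = cmod (inner_l2 (fock_rep x f) (fock_rep x f))"
      by (simp only: inner_l2_self norm_of_real abs_power2)
    also have "\<dots> = cmod (inner_l2 f (fock_rep (star x * x) f))"
      by (simp add: fock_rep_adjoint fock_rep_mult fin_supp_fock_rep f)
    also have "\<dots> \<le> norm_l2 f * norm_l2 (fock_rep (star x * x) f)"
      by (intro inner_l2_Cauchy_Schwarz fin_supp_fock_rep f)
    also have "\<dots> \<le> norm_l2 f * (fock_seminorm (star x * x) * norm_l2 f)"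
      by (intro mult_left_mono fock_rep_le f) simp
    also have "\<dots> = (sqrt (fock_seminorm (star x * x)) * norm_l2 f)\<^sup>2"
      by (simp add: power_mult_distrib fock_seminorm_nonneg power2_eq_square)
    finally show "norm_l2 (fock_rep x f) \<le> sqrt (fock_seminorm (star x * x)) * norm_l2 f"
      by (rule power2_le_imp_le) (simp add: fock_seminorm_nonneg)
  qed (simp add: fock_seminorm_nonneg)
  then have "(fock_seminorm x)\<^sup>2 \<le> (sqrt (fock_seminorm (star x * x)))\<^sup>2"
    by (rule power_mono) (rule fock_seminorm_nonneg)
  then show ?thesis by (simp add: fock_seminorm_nonneg)
qed

text \<open>One factor cancels from the previous inequality combined with submultiplicativity.
  Applied to \<open>star x\<close>, this supplies the upper half of the C*-identity.\<close>

lemma fock_seminorm_star_le: "fock_seminorm x \<le> fock_seminorm (star x)"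
proof (cases "fock_seminorm x = 0")
  case False
  have "fock_seminorm x * fock_seminorm x \<le> fock_seminorm (star x) * fock_seminorm x"
    using fock_seminorm_power2_le[of x] fock_seminorm_mult[of "star x" x]
    by (simp add: power2_eq_square)
  then show ?thesis using False fock_seminorm_nonneg[of x] by simp
qed (simp add: fock_seminorm_nonneg)

lemma cstar_seminorm_fock: "cstar_seminorm fock_seminorm"
  unfolding cstar_seminorm_def
proof (intro conjI allI)
  fix x y :: "int free_star_algebra" and c
  show "0 \<le> fock_seminorm x" by (rule fock_seminorm_nonneg)
  show "fock_seminorm (x * y) \<le> fock_seminorm x * fock_seminorm y" by (rule fock_seminorm_mult)
  show "fock_seminorm (x + y) \<le> fock_seminorm x + fock_seminorm y"
  proof (rule fock_seminorm_le)
    fix f :: "int set \<Rightarrow> complex" assume f: "fin_supp f"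
    show "norm_l2 (fock_rep (x + y) f) \<le> (fock_seminorm x + fock_seminorm y) * norm_l2 f"
      using norm_l2_triangle[OF fin_supp_fock_rep[OF f, of x] fin_supp_fock_rep[OF f, of y]]
        fock_rep_le[OF f, of x] fock_rep_le[OF f, of y]
      by (simp add: fock_rep_add distrib_right)
  qed (simp add: fock_seminorm_nonneg)
  have scale: "fock_seminorm (d *\<^sub>C z) \<le> cmod d * fock_seminorm z" for d z
    by (rule fock_seminorm_le)
      (simp_all add: fock_seminorm_nonneg fock_rep_scaleC norm_l2_scale fin_supp_fock_rep
        fock_rep_le mult.assoc mult_left_mono)
  show "fock_seminorm (c *\<^sub>C x) = cmod c * fock_seminorm x"
  proof (cases "c = 0")
    case True
    then show ?thesis using scale[of c x] fock_seminorm_nonneg[of "c *\<^sub>C x"] by simp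
  next
    case False
    \<comment> \<open>The reverse inequality is \<open>scale\<close> for the inverse scalar.\<close>
    then have "fock_seminorm x \<le> cmod (inverse c) * fock_seminorm (c *\<^sub>C x)"
      using scale[of "inverse c" "c *\<^sub>C x"] by (simp add: scaleC_scaleC scaleC_one)
    then have "cmod c * fock_seminorm x \<le> cmod c * (cmod (inverse c) * fock_seminorm (c *\<^sub>C x))"
      by (intro mult_left_mono) simp_all
    also have "\<dots> = fock_seminorm (c *\<^sub>C x)"
      using False by (simp add: norm_inverse mult.assoc[symmetric])
    finally have "cmod c * fock_seminorm x \<le> fock_seminorm (c *\<^sub>C x)" .
    then show ?thesis using scale[of c x] by simp
  qed
  have "fock_seminorm (star x * x) \<le> fock_seminorm (star x) * fock_seminorm x"
    by (rule fock_seminorm_mult)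
  also have "\<dots> \<le> fock_seminorm x * fock_seminorm x"
    using fock_seminorm_star_le[of "star x"]
    by (intro mult_right_mono fock_seminorm_nonneg) (simp add: star_star)
  finally show "fock_seminorm (star x * x) = (fock_seminorm x)\<^sup>2"
    using fock_seminorm_power2_le[of x] by (simp add: power2_eq_square)
qed

section \<open>The monotone rules on Fock space\<close>

text \<open>By \<open>ac\<close> and \<open>ca\<close> the products of an annihilator and its
  creator are diagonal: they select the sets lying above \<open>i\<close> and the sets with least
  element \<open>i\<close>. Every rule then becomes a comparison of such conditions.\<close>

lemma fock_rep_relators:
  assumes "r \<in> monotone_relators free_gen"
  shows "fock_rep r f = (\<lambda>A. 0)"
proof -
  note rep = fock_rep_mult fock_rep_gen fock_rep_star_gen fock_rep_diff fock_rep_scaleC fock_rep_sum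
  have ac: "annihilate i (create i g) A = (if \<forall>a\<in>A. i < a then g A else 0)" for i g A
  proof (cases "\<forall>a\<in>A. i < a")
    case True
    then have "insert i A - {i} = A" by auto
    then show ?thesis using True by (auto simp: annihilate_def create_def)
  next
    case False
    then show ?thesis by (simp only: annihilate_def if_False)
  qed
  have ca: "create i (annihilate i g) A = (if i \<in> A \<and> (\<forall>a\<in>A. i \<le> a) then g A else 0)" for i g A
  proof (cases "i \<in> A \<and> (\<forall>a\<in>A. i \<le> a)")
    case True
    then have "insert i (A - {i}) = A" "\<forall>a\<in>A - {i}. i < a" by (auto simp: order.strict_iff_order)
    then show ?thesis using True by (simp add: annihilate_def create_def)
  qed (auto simp: create_def)
  have 1: "annihilate i (annihilate j f) A = 0" if "i \<le> j" for i j A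
    using that by (auto simp: annihilate_def)
  have 2: "annihilate i (annihilate j (create j f)) A = monotone_coeff i j * annihilate i f A" for i j A
    by (auto simp: annihilate_def[of i] ac monotone_coeff_def)
  have 3: "create i (annihilate i f) A =
      annihilate (i - 1) (create (i - 1) f) A - annihilate i (create i f) A" for i A
    unfolding ac ca by (auto simp: order.strict_iff_order)
  have 4: "annihilate i (create i (annihilate j f)) A = annihilate j f A -
      monotone_coeff i j * (\<Sum>k\<in>{j<..i}. create k (annihilate k (annihilate j f)) A)" for i j A
  proof -
    consider (out) "\<not> (\<forall>a\<in>A. j < a)" | (ge) "\<forall>a\<in>A. j < a" "i \<le> j"
      | (above) "j < i" "\<forall>a\<in>A. i < a" | (hit) a where "\<forall>a\<in>A. j < a" "j < i" "a \<in> A" "a \<le> i"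
      by (meson not_le)
    then show ?thesis
    proof cases
      case out
      then have "annihilate j f A = 0" by (simp only: annihilate_def if_False)
      then show ?thesis by (simp add: ac ca)
    next
      case ge
      then have "\<forall>a\<in>A. i < a" by fastforce
      then show ?thesis using ge(2) by (simp add: ac monotone_coeff_def)
    next
      case above
      then have "(\<Sum>k\<in>{j<..i}. create k (annihilate k (annihilate j f)) A) = 0"
        unfolding ca by (intro sum.neutral) auto
      then show ?thesis using above(2) by (simp add: ac)
    next
      case hit
      \<comment> \<open>The least element of \<open>A\<close> exists because \<open>A\<close> lies
        above \<open>j\<close>; subtracting \<open>j\<close> moves the search to the naturals and
        also covers infinite \<open>A\<close>. Only the summand with \<open>k = m\<close>
        survives.\<close>
      obtain m where m: "m \<in> A" "\<And>y. y \<in> A \<Longrightarrow> nat (m - j) \<le> nat (y - j)"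
        using ex_has_least_nat[of "\<lambda>y. y \<in> A" a "\<lambda>y. nat (y - j)"] hit(3) by blast
      have least: "m \<le> y" if "y \<in> A" for y
        using m(2)[OF that] bspec[OF hit(1) that] by linarith
      have "(\<Sum>k\<in>{j<..i}. create k (annihilate k (annihilate j f)) A) =
          (\<Sum>k\<in>{j<..i}. if k = m then annihilate j f A else 0)"
        unfolding ca using m(1) least by (intro sum.cong) (auto intro: order.antisym)
      also have "\<dots> = annihilate j f A"
        using hit(1) m(1) least[OF hit(3)] hit(4) by simp
      finally show ?thesis
        using hit(2-4) by (auto simp: ac monotone_coeff_def)
    qed
  qed
  consider (r1) i j where "r = free_gen i * free_gen j" "i \<le> j"
    | (r2) i j where "r = free_gen i * free_gen j * star (free_gen j) - monotone_coeff i j *\<^sub>C free_gen i"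
    | (r3) i where "r = star (free_gen i) * free_gen i -
        (free_gen (i - 1) * star (free_gen (i - 1)) - free_gen i * star (free_gen i))"
    | (r4) i j where "r = free_gen i * star (free_gen i) * free_gen j - (free_gen j -
        monotone_coeff i j *\<^sub>C (\<Sum>k\<in>{j<..i}. star (free_gen k) * free_gen k * free_gen j))"
    using assms unfolding monotone_relators_def by blast
  then show ?thesis
  proof cases
    case r1
    show ?thesis unfolding r1(1) rep by (rule ext) (rule 1[OF r1(2)])
  next
    case r2
    show ?thesis unfolding r2 rep by (simp only: 2 diff_self)
  next
    case r3
    show ?thesis unfolding r3 rep by (simp only: 3 diff_self)
  next
    case r4
    show ?thesis unfolding r4 rep by (rule ext) (simp only: diff_eq_eq 4, simp)
  qed
qed

lemma fock_seminorm_relators: "r \<in> monotone_relators free_gen \<Longrightarrow> fock_seminorm r = 0"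
  using fock_seminorm_le[of 0 r] fock_seminorm_nonneg[of r] by (simp add: fock_rep_relators)

section \<open>Nonvanishing of the range projections and conclusion\<close>

text \<open>Universality bounds the Fock seminorm by the norm in the algebra, and the Fock seminorm
  of this element is at least \<open>1\<close> because its operator fixes the vacuum.\<close>

lemma universal_monotone_cstar_vacuum:
  assumes "universal_monotone_cstar b"
  shows "b i * star (b i) \<noteq> 0"
proof
  assume 0: "b i * star (b i) = 0"
  let ?x = "free_gen i * star (free_gen i)"
  \<comment> \<open>The vacuum is the basis vector indexed by the empty set.\<close>
  let ?v = "\<lambda>A :: int set. if A = {} then 1 else 0 :: complex"
  note hom = unital_star_homD[OF unital_star_hom_free_eval[of b]]
  have supp: "{A. ?v A \<noteq> 0} = {{}}" by auto
  have v: "fin_supp ?v" "norm_l2 ?v = 1" by (simp_all add: fin_supp_def norm_l2_def supp)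
  have "annihilate i (create i ?v) = ?v"
    by (rule ext) (auto simp: annihilate_def create_def)
  then have "fock_rep ?x ?v = ?v"
    by (simp only: fock_rep_mult fock_rep_gen fock_rep_star_gen)
  then have "1 \<le> fock_seminorm ?x"
    using fock_rep_le[OF v(1), of ?x] by (simp only: v(2) mult_1_right)
  also have "\<dots> \<le> norm (free_eval b ?x)"
    using assms cstar_seminorm_fock fock_seminorm_relators
    by (auto simp: universal_monotone_cstar_def universal_cstar_def)
  also have "\<dots> = 0" by (simp add: hom 0)
  finally show False by simp
qed

text \<open>The indices form the interval from \<open>- n\<close> to \<open>n\<close>, and the
  subsets of its \<open>2 * n + 1\<close> elements label the matrix units.\<close>

theorem proposition3p5:
  fixes b :: "int \<Rightarrow> 'a::cstar_algebra"
  assumes "universal_monotone_cstar b"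
  shows "\<forall>n::nat. cstar_iso_matrix_algebra (2 ^ (2 * n + 1)) (cstar_generated {b i | i. \<bar>i\<bar> \<le> int n})"
proof
  fix n :: nat
  interpret monotone_family b
    by unfold_locales (rule universal_monotone_cstar_rules[OF assms]; assumption)+
  have "range_proj (int n) \<noteq> 0"
    unfolding range_proj_def by (rule universal_monotone_cstar_vacuum[OF assms])
  moreover have "{b i | i. \<bar>i\<bar> \<le> int n} = b ` {- int n..int n}"
    by (auto simp: abs_le_iff)
  moreover have "card {- int n..int n} = 2 * n + 1" by simp
  ultimately show "cstar_iso_matrix_algebra (2 ^ (2 * n + 1)) (cstar_generated {b i | i. \<bar>i\<bar> \<le> int n})"
    using cstar_generated_interval_iso[of "int n" "- int n"] by simp
qed

end
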